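(* Let $\rho$ be the autocovariance function of the weakly stationary solution $X$ of the ARCH($\infty$) equations with data $a$, $b$, $\xi$. Suppose that $\lambda_1B<1$ and $\Omega<1$, and that $\gamma\in\mathcal{W}^{\downarrow}(r)$ for some $r\in(0,1]$. Then the following are equivalent: (a) $\lambda_1\sum_{j=1}^\infty b(j)r^{-j}<1$ and there exists $C_0\in(0,\infty)$ such that $b(n)\le C_0\gamma(n)$ for all $n\ge1$; (b) there exists $C_2\in(0,\infty)$ such that $\rho(n)\le C_2\gamma(n)$ for all $n\ge0$.
   Context: ARCH($\infty$) setting. Let $\xi=\{\xi(k)\}_{k\in\mathbb{Z}}$ be i.i.d. non-negative random variables, $a\ge 0$ a constant, and $b=\{b(j)\}_{j\ge1}$ a real sequence with $b(j)\ge 0$. A random sequence $X=\{X(k)\}_{k\in\mathbb{Z}}$ satisfies the ARCH($\infty$) equations if $X(k)=\varsigma(k)\xi(k)$, $\varsigma(k)=a+\sum_{j=1}^\infty b(j)X(k-j)$ for all $k\in\mathbb{Z}$. Put $\lambda_1=\mathbb{E}[\xi(0)]$, $\lambda_2=\mathbb{E}[\xi(0)^2]$, $\sigma^2=\mathrm{Var}[\xi(0)]=\lambda_2-\lambda_1^2$, $B=\sum_{j=1}^\infty b(j)$, $\nu(k)=X(k)-\lambda_1\varsigma(k)$. Standing assumptions: $\lambda_1\in(0,\infty)$, $a>0$, $\sigma\in(0,\infty)$, and $b$ is not identically zero. The sequence $z$ is defined by $z(0)=1$, $z(n)=\lambda_1\sum_{j=0}^{n-1}b(n-j)z(j)$ for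 $n\ge 1$ (when $\lambda_1B<1$, these are the power series coefficients of $1/(1-\lambda_1\sum_{j\ge1}b(j)\lambda^j)$ on $|\lambda|\le 1$), and $\Omega=\frac{\sigma}{\lambda_1}\big(\sum_{j=1}^\infty z(j)^2\big)^{1/2}$. A process is (weakly) stationary if it has constant finite mean and $\mathrm{Cov}[X(n),X(n+k)]$ depends only on $k$; $\rho(k)=\mathrm{Cov}[X(n),X(n+k)]$, $k\in\mathbb{Z}$, is its autocovariance function. Known fact (recalled by the paper): if $\lambda_1B<1$ and $\Omega<1$, there is a unique weakly stationary solution $X$ of the ARCH($\infty$) equations; it satisfies $\rho(k)=\mathbb{E}[\nu(0)^2]\sum_{j=0}^\infty z(j)z(j+|k|)$ for $k\in\mathbb{Z}$, with $\mathbb{E}[\nu(0)^2]=\big(\frac{a\sigma}{1-\lambda_1B}\big)^2\frac{1}{1-\Omega^2}$. Weight classes. For finite $r>0$, a real sequence $\gamma=\{\gamma(n)\}_{n\ge0}$ is in $\mathcal{W}(r)$ if $\gamma(n)>0$ for all $n\ge 0$, $\lim_{n\to\infty}\gamma(n-1)/\gamma(n)=1/r$, $\sum_{i=0}^\infty\gamma(i)r^{-i}<\infty$, and $\lim_{m\to\infty}\big(\limsup_{n\to\infty}\frac1{\gamma(n)}\sum_{i=m}^{n-m}\gamma(n-i)\gamma(i)\big)=0$. For $r\in(0,1]$, $\mathcal{W}^{\downarrow}(r)$ is the set of $g\in\mathcal{W}(r)$ for which there is a non-increasing positive sequence $\delta=\{\delta(n)\}_{n\ge0}$ with $g(n)/\delta(n)\to1$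 as $n\to\infty$. *)

theory Defs
  imports "HOL-Probability.Probability"
begin

text \<open>
  The kernel is a function \<open>b :: nat \<Rightarrow> real\<close> of which only the values \<open>b j\<close> with
  \<open>j \<ge> 1\<close> are used: a sum over \<open>j \<ge> 1\<close> is a series in \<open>b (Suc j)\<close> with \<open>j \<ge> 0\<close>.
\<close>

definition arch_volatility ::
    "real \<Rightarrow> (nat \<Rightarrow> real) \<Rightarrow> (int \<Rightarrow> 'w \<Rightarrow> real) \<Rightarrow> int \<Rightarrow> 'w \<Rightarrow> real" where
  "arch_volatility a b X k \<omega> = a + (\<Sum>j. b (Suc j) * X (k - int (Suc j)) \<omega>)"

text \<open>
  The equations hold almost surely. Since \<open>suminf\<close> is total, convergence of the series
  is stated separately.
\<close>

definition arch_solution ::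
    "'w measure \<Rightarrow> real \<Rightarrow> (nat \<Rightarrow> real) \<Rightarrow> (int \<Rightarrow> 'w \<Rightarrow> real) \<Rightarrow> (int \<Rightarrow> 'w \<Rightarrow> real) \<Rightarrow> bool" where
  "arch_solution M a b \<xi> X \<longleftrightarrow>
     (\<forall>k. X k \<in> borel_measurable M) \<and>
     (\<forall>k. AE \<omega> in M. summable (\<lambda>j. b (Suc j) * X (k - int (Suc j)) \<omega>) \<and>
                     X k \<omega> = arch_volatility a b X k \<omega> * \<xi> k \<omega>)"

definition cov :: "'w measure \<Rightarrow> ('w \<Rightarrow> real) \<Rightarrow> ('w \<Rightarrow> real) \<Rightarrow> real" where
  "cov M U V = (\<integral>\<omega>. (U \<omega> - (\<integral>\<omega>'. U \<omega>' \<partial>M)) * (V \<omega> - (\<integral>\<omega>'. V \<omega>' \<partial>M)) \<partial>M)"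

text \<open>
  Square integrability makes all the covariances genuine integrals.
\<close>

definition weakly_stationary :: "'w measure \<Rightarrow> (int \<Rightarrow> 'w \<Rightarrow> real) \<Rightarrow> bool" where
  "weakly_stationary M X \<longleftrightarrow>
     (\<forall>n. integrable M (X n) \<and> integrable M (\<lambda>\<omega>. (X n \<omega>)\<^sup>2)) \<and>
     (\<forall>n m. (\<integral>\<omega>. X n \<omega> \<partial>M) = (\<integral>\<omega>. X m \<omega> \<partial>M)) \<and>
     (\<forall>n m k. cov M (X n) (X (n + k)) = cov M (X m) (X (m + k)))"

fun arch_z :: "real \<Rightarrow> (nat \<Rightarrow> real) \<Rightarrow> nat \<Rightarrow> real" where
  "arch_z l b 0 = 1"
| "arch_z l b (Suc n) = l * (\<Sum>j=0..n. b (Suc n - j) * arch_z l b j)"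

text \<open>
  The arguments are the mean \<open>l\<close> and the standard deviation \<open>s\<close> of the innovations. If \<open>b \<ge> 0\<close>
  is summable with \<open>l * (\<Sum>j. b (Suc j)) < 1\<close>, then \<open>arch_z l b\<close> is summable, so that the
  series of squares converges.
\<close>

definition arch_Omega :: "real \<Rightarrow> real \<Rightarrow> (nat \<Rightarrow> real) \<Rightarrow> real" where
  "arch_Omega l s b = s / l * sqrt (\<Sum>j. (arch_z l b (Suc j))\<^sup>2)"

text \<open>
  The inner limit superior is taken in the extended reals, where it always exists. The truncated
  subtraction \<open>n - m\<close> is harmless: for \<open>n < 2 * m\<close> the range of summation is empty.
\<close>

definition weight_class :: "real \<Rightarrow> (nat \<Rightarrow> real) set" where
  "weight_class r = {\<gamma>.
     (\<forall>n. \<gamma> n > 0) \<and>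
     (\<lambda>n. \<gamma> n / \<gamma> (Suc n)) \<longlonglongrightarrow> 1 / r \<and>
     summable (\<lambda>i. \<gamma> i / r ^ i) \<and>
     (\<lambda>m. limsup (\<lambda>n. ereal ((1 / \<gamma> n) * (\<Sum>i=m..n - m. \<gamma> (n - i) * \<gamma> i)))) \<longlonglongrightarrow> 0}"

definition weight_class_down :: "real \<Rightarrow> (nat \<Rightarrow> real) set" where
  "weight_class_down r = {g \<in> weight_class r.
     \<exists>\<delta>. (\<forall>n. \<delta> n > 0) \<and> decseq \<delta> \<and> (\<lambda>n. g n / \<delta> n) \<longlonglongrightarrow> 1}"

end

theory Submission
  imports Defs "HOL-Computational_Algebra.Formal_Power_Series"
begin

text \<open>
  Everything rests on the formula \<open>\<rho>(k) = s * (\<Sum>i. z(i) * z(i + k))\<close> with \<open>s > 0\<close>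
  (\<open>autocovariance\<close>). Write \<open>l\<close> for the mean of the innovations and
  \<open>\<phi>(j) = l * b(j)\<close>, so that \<open>z = \<delta> + \<phi> * z\<close> with \<open>*\<close> the convolution and \<open>\<delta>\<close> the unit
  mass at \<open>0\<close>. All terms are non-negative, hence \<open>\<rho>(n) \<ge> s * z(n) \<ge> s * \<phi>(n)\<close>. An upper bound
  \<open>\<gamma>\<close> for \<open>\<rho>\<close> therefore bounds \<open>z\<close> and \<open>b\<close>; it makes \<open>A = (\<Sum>n. z(n) / r^n)\<close> finite, and the
  renewal equation at \<open>1/r\<close>, \<open>A = 1 + A * Q\<close> with \<open>Q = (\<Sum>n. \<phi>(n) / r^n)\<close>, forces \<open>Q < 1\<close>
  (\<open>kernel_transform_less_1\<close>). Conversely, if \<open>Q < 1\<close> and \<open>\<phi>\<close> is bounded by a multiple of the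
  weight \<open>\<gamma>\<close>, then so is \<open>z\<close> (\<open>z_le_weight\<close>), because in \<open>z(n) = (\<Sum>i. \<phi>(n - i) * z(i))\<close> only
  the two ends of the sum count; since \<open>\<gamma>\<close> is comparable to a non-increasing sequence,
  \<open>z(i + n)\<close> is bounded by a multiple of \<open>\<gamma>(n)\<close> uniformly in \<open>i\<close>, and this bounds \<open>\<rho>(n)\<close>.

  The formula for \<open>\<rho>\<close> follows from the representation \<open>X(k) = E X + (\<Sum>j. z(j) * \<nu>(k - j))\<close>,
  a linear inversion that holds for every stationary solution (\<open>X_inversion\<close>), once the \<open>\<nu>(k)\<close>
  are known to be uncorrelated. With \<open>\<epsilon> = \<xi> - l\<close> one has \<open>\<nu>(k) = \<epsilon>(k) * vol(k)\<close>, where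
  \<open>vol(k)\<close> denotes the volatility, and they are uncorrelated if \<open>vol(k)\<close> is a function of the
  innovations before time \<open>k\<close>. A stationary solution may a priori look into the future, so this
  causality has to be derived (\<open>vol_causal\<close>).

  To this end the inversion is rewritten as
  \<open>\<nu>(k) = \<epsilon>(k) * (m + (\<Sum>j. \<zeta>(j) * \<nu>(k - j)))\<close> with a constant \<open>m\<close> and \<open>\<zeta>(j) = z(j) / l\<close> for
  \<open>j \<ge> 1\<close>, and iterated \<open>N\<close> times. This gives an explicit causal part and a remainder
  \<open>(\<Sum>n. P(n) * \<nu>(k - n))\<close>, in which \<open>P(n)\<close> sums products of the \<open>\<epsilon>\<close> along all chains of
  \<open>N\<close> steps and total length \<open>n\<close>. Different chains are orthogonal, so the second moment of
  \<open>P(n)\<close> is the \<open>n\<close>-th coefficient of the \<open>N\<close>-th convolution power of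
  \<open>h(j) = Var \<xi> * \<zeta>(j)^2\<close>, whose total mass is \<open>\<Omega>^2 < 1\<close>. As \<open>\<nu>(k - n)\<close> may depend on \<open>P(n)\<close>,
  only the Cauchy-Schwarz inequality is available, and it bounds the remainder by the sum of the
  square roots of these coefficients. That this sum also decays geometrically in \<open>N\<close>, although
  only \<open>\<Omega> < 1\<close> is assumed and the square roots of \<open>h\<close> may have a sum above \<open>1\<close>, is the key estimate
  \<open>sqrt_mass_power_decay\<close>.
\<close>

section \<open>Convolutions and square-root masses\<close>

text \<open>
  A nested series \<open>\<Sum>i. p i * (\<Sum>j. q j * x (i + j))\<close> is what one substitution of a linear recursion
  into itself produces. Summing over the level sets of \<open>i + j\<close> collects the coefficient of each \<open>x n\<close>.
\<close>

lemma convolution_exchange: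
  fixes p q x :: "nat \<Rightarrow> real"
  assumes S: "summable (\<lambda>n. (\<Sum>i\<le>n. \<bar>p i\<bar> * \<bar>q (n - i)\<bar>) * \<bar>x n\<bar>)"
  shows "(\<lambda>i. p i * (\<Sum>j. q j * x (i + j))) sums (\<Sum>n. (\<Sum>i\<le>n. p i * q (n - i)) * x n)"
proof -
  define F where "F = (\<lambda>(n, i). p i * q (n - i) * x n)"
  have out: "(\<lambda>n. norm (infsum (\<lambda>i. norm (F (n, i))) {..n})) summable_on UNIV"
    using S by (intro norm_summable_imp_summable_on)
      (simp add: F_def abs_mult sum_distrib_right sum_nonneg)
  have "(\<lambda>u. norm (F u)) summable_on (SIGMA n:UNIV. {..n})"
    by (rule Infinite_Sum.abs_summable_on_Sigma_iff[THEN iffD2]) (use out in auto)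
  hence F1: "F summable_on (SIGMA n:UNIV. {..n})"
    by (rule abs_summable_summable)
  have bij: "bij_betw (\<lambda>(i, j). (i + j, i)) (UNIV \<times> UNIV) (SIGMA n:UNIV. {..n::nat})"
    by (rule bij_betwI[where g = "\<lambda>(n, i). (i, n - i)"]) auto
  have F2: "(\<lambda>(i, j). p i * q j * x (i + j)) summable_on (UNIV \<times> UNIV)"
    using F1 unfolding summable_on_reindex_bij_betw[OF bij, symmetric]
    by (simp add: F_def case_prod_unfold)
  have eq: "infsum (\<lambda>(i, j). p i * q j * x (i + j)) (UNIV \<times> UNIV) = infsum F (SIGMA n:UNIV. {..n})"
    unfolding infsum_reindex_bij_betw[OF bij, symmetric] by (simp add: F_def case_prod_unfold)
  have rows: "infsum (\<lambda>j. p i * q j * x (i + j)) UNIV = p i * (\<Sum>j. q j * x (i + j))" for i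
  proof (cases "p i = 0")
    case False
    have "(\<lambda>j. p i * q j * x (i + j)) summable_on UNIV"
      using summable_on_subset_banach[OF F2, of "range (Pair i)"]
        summable_on_reindex[of "Pair i" UNIV "\<lambda>(i, j). p i * q j * x (i + j)"]
      by (simp add: o_def inj_on_def)
    hence "(\<lambda>j. p i * q j * x (i + j)) sums infsum (\<lambda>j. p i * q j * x (i + j)) UNIV"
      by (intro has_sum_imp_sums has_sum_infsum)
    hence *: "(\<lambda>j. p i * (q j * x (i + j))) sums infsum (\<lambda>j. p i * q j * x (i + j)) UNIV"
      by (simp add: mult.assoc)
    hence "summable (\<lambda>j. q j * x (i + j))"
      using False summable_mult_D[of "p i"] by (auto simp: sums_iff)
    thus ?thesis using * suminf_mult by (metis sums_iff)
  qed auto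
  have "(\<lambda>i. infsum (\<lambda>j. p i * q j * x (i + j)) UNIV) sums infsum F (SIGMA n:UNIV. {..n})"
    using has_sum_imp_sums[OF has_sum_infsum[OF summable_on_Sigma_banach[OF F2]]]
    unfolding infsum_Sigma'_banach[OF F2] eq .
  moreover have "(\<Sum>n. (\<Sum>i\<le>n. p i * q (n - i)) * x n) = infsum F (SIGMA n:UNIV. {..n})"
  proof -
    have F3: "(\<lambda>(n, i). p i * q (n - i) * x n) summable_on (SIGMA n:UNIV. {..n})"
      using F1 by (simp add: F_def)
    have "(\<lambda>n. infsum (\<lambda>i. p i * q (n - i) * x n) {..n}) sums infsum F (SIGMA n:UNIV. {..n})"
      using has_sum_imp_sums[OF has_sum_infsum[OF summable_on_Sigma_banach[OF F3]]]
      unfolding infsum_Sigma'_banach[OF F3] F_def .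
    thus ?thesis by (simp add: sums_iff sum_distrib_right)
  qed
  ultimately show ?thesis by (simp add: rows)
qed

lemma summable_Cauchy_nonneg:
  fixes p q :: "nat \<Rightarrow> real"
  assumes "\<And>i. 0 \<le> p i" "\<And>i. 0 \<le> q i" "summable p" "summable q"
  shows "(\<lambda>n. \<Sum>i\<le>n. p i * q (n - i)) sums ((\<Sum>i. p i) * (\<Sum>i. q i))"
  using Cauchy_product_sums[of p q] assms by simp

text \<open>
  Bounds for all partial sums stand for summability together with a bound for the sum; this form is
  stable under products of formal power series without any discussion of convergence.
\<close>

definition mass_le :: "real fps \<Rightarrow> real \<Rightarrow> bool" where
  "mass_le f c \<longleftrightarrow> (\<forall>n. 0 \<le> fps_nth f n) \<and> (\<forall>m. (\<Sum>n<m. fps_nth f n) \<le> c)"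

definition sqrt_mass_le :: "real fps \<Rightarrow> real \<Rightarrow> bool" where
  "sqrt_mass_le f c \<longleftrightarrow> (\<forall>n. 0 \<le> fps_nth f n) \<and> (\<forall>m. (\<Sum>n<m. sqrt (fps_nth f n)) \<le> c)"

lemma sum_convolution_le:
  fixes p q :: "nat \<Rightarrow> real"
  assumes "\<And>n. 0 \<le> p n" "\<And>n. 0 \<le> q n"
  shows "(\<Sum>n<m. \<Sum>i\<le>n. p i * q (n - i)) \<le> (\<Sum>n<m. p n) * (\<Sum>n<m. q n)"
proof -
  have "(\<Sum>n<m. \<Sum>i\<le>n. p i * q (n - i)) = (\<Sum>(i, j)\<in>{(i, j). i + j < m}. p i * q j)"
    by (simp add: sum.triangle_reindex)
  also have "\<dots> \<le> (\<Sum>(i, j)\<in>{..<m} \<times> {..<m}. p i * q j)"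
    by (intro sum_mono2) (auto simp: assms)
  also have "\<dots> = (\<Sum>i<m. p i) * (\<Sum>j<m. q j)"
    by (simp add: sum_product sum.cartesian_product)
  finally show ?thesis .
qed

lemma sum_convolution_le_bounds:
  fixes p q :: "nat \<Rightarrow> real"
  assumes p: "\<And>n. 0 \<le> p n" and q: "\<And>n. 0 \<le> q n"
    and c: "\<And>m. (\<Sum>n<m. p n) \<le> c" and d: "\<And>m. (\<Sum>n<m. q n) \<le> d"
  shows "(\<Sum>n<m. \<Sum>i\<le>n. p i * q (n - i)) \<le> c * d"
proof -
  have "(\<Sum>n<m. \<Sum>i\<le>n. p i * q (n - i)) \<le> (\<Sum>n<m. p n) * (\<Sum>n<m. q n)"
    by (rule sum_convolution_le[OF p q])
  also have "\<dots> \<le> c * d"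
    using c[of 0] by (intro mult_mono c d sum_nonneg q) auto
  finally show ?thesis .
qed

lemma sqrt_mass_le_summable:
  assumes "sqrt_mass_le f C"
  shows "summable (\<lambda>n. sqrt (fps_nth f n))" "(\<Sum>n. sqrt (fps_nth f n)) \<le> C"
proof -
  show s: "summable (\<lambda>n. sqrt (fps_nth f n))"
    by (rule summableI_nonneg_bounded[where x = C]) (use assms in \<open>auto simp: sqrt_mass_le_def\<close>)
  show "(\<Sum>n. sqrt (fps_nth f n)) \<le> C"
    by (rule suminf_le_const[OF s]) (use assms in \<open>auto simp: sqrt_mass_le_def\<close>)
qed

lemma mass_le_mult: "mass_le f c \<Longrightarrow> mass_le g d \<Longrightarrow> mass_le (f * g) (c * d)"
  using sum_convolution_le_bounds[of "fps_nth f" "fps_nth g" c d]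
  by (auto simp: mass_le_def fps_mult_nth atLeast0AtMost intro!: sum_nonneg)

lemma sqrt_sum_le: "finite A \<Longrightarrow> (\<And>i. i \<in> A \<Longrightarrow> 0 \<le> u i) \<Longrightarrow> sqrt (sum u A) \<le> (\<Sum>i\<in>A. sqrt (u i))"
  by (induction A rule: finite_induct)
     (auto intro!: order_trans[OF sqrt_add_le_add_sqrt] sum_nonneg)

text \<open>
  The sum of the square roots is submultiplicative for the convolution, because the square root is
  subadditive.
\<close>

lemma sqrt_mass_le_mult:
  assumes "sqrt_mass_le f c" "sqrt_mass_le g d"
  shows "sqrt_mass_le (f * g) (c * d)"
proof -
  have f: "0 \<le> fps_nth f n" and g: "0 \<le> fps_nth g n" for n
    using assms by (auto simp: sqrt_mass_le_def)
  have "(\<Sum>n<m. sqrt (fps_nth (f * g) n)) \<le> c * d" for m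
  proof -
    have "(\<Sum>n<m. sqrt (fps_nth (f * g) n))
        \<le> (\<Sum>n<m. \<Sum>i\<le>n. sqrt (fps_nth f i) * sqrt (fps_nth g (n - i)))"
      using f g unfolding fps_mult_nth atLeast0AtMost real_sqrt_mult[symmetric]
      by (intro sum_mono sqrt_sum_le) auto
    also have "\<dots> \<le> c * d"
      using assms by (intro sum_convolution_le_bounds) (auto simp: sqrt_mass_le_def)
    finally show ?thesis .
  qed
  thus ?thesis using f g
    by (auto simp: sqrt_mass_le_def fps_mult_nth intro!: sum_nonneg)
qed

lemma sqrt_mass_le_add:
  assumes "sqrt_mass_le f c" "sqrt_mass_le g d"
  shows "sqrt_mass_le (f + g) (c + d)"
proof -
  have "(\<Sum>n<m. sqrt (fps_nth (f + g) n)) \<le> c + d" for m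
  proof -
    have "(\<Sum>n<m. sqrt (fps_nth (f + g) n))
        \<le> (\<Sum>n<m. sqrt (fps_nth f n)) + (\<Sum>n<m. sqrt (fps_nth g n))"
      unfolding sum.distrib[symmetric] using assms
      by (intro sum_mono) (auto simp: sqrt_mass_le_def intro: sqrt_add_le_add_sqrt)
    also have "\<dots> \<le> c + d" using assms by (intro add_mono) (auto simp: sqrt_mass_le_def)
    finally show ?thesis .
  qed
  thus ?thesis using assms by (auto simp: sqrt_mass_le_def)
qed

text \<open>
  On a support of size \<open>d + 1\<close> the Cauchy-Schwarz inequality exchanges the sum of the square roots
  for the square root of the sum, at the price of a factor \<open>sqrt (d + 1)\<close>.
\<close>

lemma sqrt_mass_le_of_mass_le:
  assumes f: "mass_le f c" and supp: "\<And>n. d < n \<Longrightarrow> fps_nth f n = 0"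
  shows "sqrt_mass_le f (sqrt (real (d + 1) * c))"
proof -
  have nn: "0 \<le> fps_nth f n" for n using f by (auto simp: mass_le_def)
  have "(\<Sum>n<m. sqrt (fps_nth f n)) \<le> sqrt (real (d + 1) * c)" for m
  proof -
    have "(\<Sum>n<m. sqrt (fps_nth f n)) = (\<Sum>n\<in>{..<m} \<inter> {..d}. sqrt (fps_nth f n))"
      by (rule sum.mono_neutral_right) (use supp in force)+
    also have "\<dots> \<le> (\<Sum>n\<le>d. sqrt (fps_nth f n))"
      by (rule sum_mono2) (auto simp: nn)
    also have "\<dots> \<le> sqrt (real (d + 1) * c)"
    proof (rule real_le_rsqrt)
      have "(\<Sum>n\<le>d. sqrt (fps_nth f n))\<^sup>2 \<le> (\<Sum>n\<le>d. 1\<^sup>2) * (\<Sum>n\<le>d. (sqrt (fps_nth f n))\<^sup>2)"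
        using Cauchy_Schwarz_ineq_sum[of "\<lambda>_. 1" "\<lambda>n. sqrt (fps_nth f n)" "{..d}"] by simp
      also have "\<dots> = real (d + 1) * (\<Sum>n<Suc d. fps_nth f n)"
        by (simp add: nn lessThan_Suc_atMost)
      also have "\<dots> \<le> real (d + 1) * c"
        using f by (intro mult_left_mono) (auto simp: mass_le_def simp del: sum.lessThan_Suc)
      finally show "(\<Sum>n\<le>d. sqrt (fps_nth f n))\<^sup>2 \<le> real (d + 1) * c" .
    qed
    finally show ?thesis .
  qed
  thus ?thesis using nn by (auto simp: sqrt_mass_le_def)
qed

lemma mass_le_power: "mass_le f c \<Longrightarrow> mass_le (f ^ k) (c ^ k)"
proof (induction k)
  case 0
  have "(\<Sum>n<m. fps_nth (1 :: real fps) n) \<le> 1" for m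
    by (cases m) (auto simp: sum.lessThan_Suc_shift simp del: sum.lessThan_Suc)
  thus ?case by (auto simp: mass_le_def)
qed (auto intro: mass_le_mult)

lemma fps_power_support:
  fixes f :: "real fps"
  assumes "\<And>n. d < n \<Longrightarrow> fps_nth f n = 0"
  shows "k * d < n \<Longrightarrow> fps_nth (f ^ k) n = 0"
proof (induction k arbitrary: n)
  case (Suc k)
  show ?case unfolding power_Suc fps_mult_nth
  proof (intro sum.neutral ballI)
    fix i assume "i \<in> {0..n}"
    thus "fps_nth f i * fps_nth (f ^ k) (n - i) = 0"
      using Suc.prems Suc.IH[of "n - i"] assms[of i] by (cases "i \<le> d") auto
  qed
qed auto

text \<open>
  The growth rate of the sum of the square roots along convolution powers is governed by the mass of
  \<open>h\<close> alone. For finitely supported \<open>h\<close> this holds since the support of \<open>h ^ k\<close> grows linearly in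
  \<open>k\<close>, which costs only a factor of order \<open>sqrt k\<close>. In general \<open>h\<close> is split into a finitely supported
  part \<open>h1\<close> and a tail \<open>h2\<close> whose square roots have a small sum \<open>\<delta>\<close>. Replacing the factors of
  \<open>h ^ k\<close> one at a time by \<open>h1 + h2\<close>, each factor \<open>h1\<close> contributes a rate \<open>\<alpha>\<close> slightly above the
  square root of the mass and each factor \<open>h2\<close> contributes \<open>\<delta>\<close>, so that the overall rate is
  \<open>\<alpha> + \<delta> < 1\<close>.
\<close>

lemma sqrt_mass_power_decay:
  fixes h :: "real fps"
  assumes nn: "\<And>n. 0 \<le> fps_nth h n" and sq: "summable (\<lambda>n. sqrt (fps_nth h n))"
    and H: "summable (fps_nth h)" "(\<Sum>n. fps_nth h n) < 1"
  obtains C \<theta> where "0 < \<theta>" "\<theta> < 1" "0 \<le> C" "\<And>k. sqrt_mass_le (h ^ k) (C * \<theta> ^ k)"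
proof -
  define s where "s = sqrt (\<Sum>n. fps_nth h n)"
  have s: "0 \<le> s" "s < 1" using H nn by (auto simp: s_def suminf_nonneg)
  (* The rates are chosen so that s < \<alpha> and \<alpha> + \<delta> = (1 + s) / 2 < 1. *)
  define \<alpha> where "\<alpha> = (1 + 2 * s) / 3"
  define \<delta> where "\<delta> = (1 - s) / 6"
  have \<alpha>: "s < \<alpha>" "0 < \<alpha>" "\<alpha> + \<delta> < 1" "0 < \<delta>"
    using s by (auto simp: \<alpha>_def \<delta>_def field_simps)
  obtain L where "\<forall>n\<ge>L. norm (\<Sum>i. sqrt (fps_nth h (i + n))) < \<delta>"
    using suminf_exist_split[OF \<alpha>(4) sq] by blast
  hence L: "(\<Sum>n. sqrt (fps_nth h (n + L))) < \<delta>" by auto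
  define h1 where "h1 = Abs_fps (\<lambda>n. if n < L then fps_nth h n else 0)"
  define h2 where "h2 = Abs_fps (\<lambda>n. if n < L then 0 else fps_nth h n)"
  have h: "h = h1 + h2" by (rule fps_ext) (simp add: h1_def h2_def)
  have tail: "sqrt_mass_le h2 \<delta>"
  proof -
    have "(\<Sum>n<m. sqrt (fps_nth h2 n)) \<le> \<delta>" for m
    proof -
      have "(\<Sum>n<m. sqrt (fps_nth h2 n)) \<le> (\<Sum>n<m + L. sqrt (fps_nth h2 n))"
        by (rule sum_mono2) (auto simp: h2_def nn)
      also have "\<dots> = (\<Sum>n\<in>{L..<m + L}. sqrt (fps_nth h n))"
        by (rule sum.mono_neutral_cong_right) (auto simp: h2_def)
      also have "\<dots> = (\<Sum>n<m. sqrt (fps_nth h (n + L)))"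
        using sum.shift_bounds_nat_ivl[of "\<lambda>n. sqrt (fps_nth h n)" 0 L m]
        by (simp add: atLeast0LessThan)
      also have "\<dots> \<le> (\<Sum>n. sqrt (fps_nth h (n + L)))"
        by (rule sum_le_suminf) (use nn summable_ignore_initial_segment[OF sq] in auto)
      finally show ?thesis using L by linarith
    qed
    thus ?thesis by (auto simp: sqrt_mass_le_def h2_def nn)
  qed
  have m1: "mass_le h1 (s\<^sup>2)"
  proof -
    have "(\<Sum>n<m. fps_nth h1 n) \<le> s\<^sup>2" for m
    proof -
      have "(\<Sum>n<m. fps_nth h1 n) \<le> (\<Sum>n<m. fps_nth h n)"
        by (rule sum_mono) (auto simp: h1_def nn)
      also have "\<dots> \<le> (\<Sum>n. fps_nth h n)" by (rule sum_le_suminf) (use H nn in auto)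
      finally show ?thesis using nn H by (simp add: s_def suminf_nonneg)
    qed
    thus ?thesis by (auto simp: mass_le_def h1_def nn)
  qed
  have base: "sqrt_mass_le (h1 ^ i) (sqrt (real (i * L + 1)) * s ^ i)" for i
  proof -
    have "sqrt_mass_le (h1 ^ i) (sqrt (real (i * L + 1) * (s\<^sup>2) ^ i))"
      by (rule sqrt_mass_le_of_mass_le[OF mass_le_power[OF m1]], rule fps_power_support[where d = L])
         (auto simp: h1_def)
    thus ?thesis using s by (simp add: real_sqrt_mult real_sqrt_power)
  qed
  (* The gap between s and \<alpha> absorbs the factor coming from the size of the support. *)
  obtain C where C: "\<And>i. sqrt (real (i * L + 1)) * s ^ i \<le> C * \<alpha> ^ i"
  proof -
    have "(\<lambda>i. real i * (s / \<alpha>) ^ i) \<longlonglongrightarrow> 0"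
      by (rule powser_times_n_limit_0) (use s \<alpha> in auto)
    hence "Bseq (\<lambda>i. real i * (s / \<alpha>) ^ i)" by (meson Bseq_conv_Bfun convergentI convergent_imp_Bseq)
    then obtain K where K: "\<And>i. \<bar>real i * (s / \<alpha>) ^ i\<bar> \<le> K" by (auto simp: Bseq_def)
    have "sqrt (real (i * L + 1)) * s ^ i \<le> (K * L + 1) * \<alpha> ^ i" for i
    proof -
      have "sqrt (real (i * L + 1)) \<le> real (i * L + 1)" 
        by (rule real_le_lsqrt) (use self_le_power[of "real (i * L + 1)" 2] in auto)
      hence "sqrt (real (i * L + 1)) * (s / \<alpha>) ^ i \<le> real (i * L + 1) * (s / \<alpha>) ^ i"
        using s \<alpha> by (intro mult_right_mono) auto
      also have "\<dots> = (real i * (s / \<alpha>) ^ i) * L + (s / \<alpha>) ^ i" by (simp add: algebra_simps)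
      also have "\<dots> \<le> K * L + 1"
        using K[of i] s \<alpha> by (intro add_mono mult_right_mono power_le_one) auto
      finally show ?thesis using \<alpha> by (simp add: power_divide field_simps)
    qed
    thus ?thesis using that by blast
  qed
  have C0: "0 \<le> C" using C[of 0] s by auto
  have mono: "sqrt_mass_le f c \<Longrightarrow> c \<le> d \<Longrightarrow> sqrt_mass_le f d" for f c d
    
    unfolding sqrt_mass_le_def by (meson order_trans)
  have "sqrt_mass_le (h ^ k * h1 ^ i) (C * \<alpha> ^ i * (\<alpha> + \<delta>) ^ k)" for k i
  proof (induction k arbitrary: i)
    case 0
    show ?case using mono[OF base C] by simp
  next
    case (Suc k)
    have eq: "h ^ Suc k * h1 ^ i = h ^ k * h1 ^ Suc i + h ^ k * h1 ^ i * h2"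
      by (subst power_Suc, subst (1) h) (simp add: algebra_simps)
    have "C * \<alpha> ^ i * (\<alpha> + \<delta>) ^ Suc k = C * \<alpha> ^ Suc i * (\<alpha> + \<delta>) ^ k + C * \<alpha> ^ i * (\<alpha> + \<delta>) ^ k * \<delta>"
      by (simp add: algebra_simps)
    thus ?case unfolding eq
      using sqrt_mass_le_add[OF Suc.IH[of "Suc i"] sqrt_mass_le_mult[OF Suc.IH[of i] tail]] by simp
  qed
  from this[of _ 0] have "sqrt_mass_le (h ^ k) (C * (\<alpha> + \<delta>) ^ k)" for k by simp
  thus ?thesis using that[of "\<alpha> + \<delta>" C] \<alpha> C0 by auto
qed

section \<open>The renewal sequence and weight sequences\<close>

text \<open>
  The value \<open>0\<close> at \<open>0\<close> turns the recursion for \<open>arch_z\<close> into a plain convolution identity.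
\<close>

definition renewal_kernel :: "real \<Rightarrow> (nat \<Rightarrow> real) \<Rightarrow> nat \<Rightarrow> real" where
  "renewal_kernel l b j = (if j = 0 then 0 else l * b j)"

lemma arch_z_renewal:
  "(\<Sum>i\<le>n. arch_z l b i * renewal_kernel l b (n - i)) = (if n = 0 then 0 else arch_z l b n)"
proof (cases n)
  case (Suc m)
  have "(\<Sum>i\<le>n. arch_z l b i * renewal_kernel l b (n - i)) = (\<Sum>i\<le>m. arch_z l b i * renewal_kernel l b (n - i))"
    using Suc by (simp add: renewal_kernel_def)
  also have "\<dots> = (\<Sum>i\<le>m. l * (b (Suc m - i) * arch_z l b i))"
    by (rule sum.cong) (use Suc in \<open>auto simp: renewal_kernel_def\<close>)
  also have "\<dots> = arch_z l b n" by (simp add: Suc sum_distrib_left atLeast0AtMost)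
  finally show ?thesis using Suc by simp
qed (simp add: renewal_kernel_def)

locale renewal =
  fixes l :: real and b :: "nat \<Rightarrow> real"
  assumes l_pos: "0 < l" and b_nonneg: "1 \<le> j \<Longrightarrow> 0 \<le> b j"
begin

abbreviation z :: "nat \<Rightarrow> real" where "z \<equiv> arch_z l b"
abbreviation \<phi> :: "nat \<Rightarrow> real" where "\<phi> \<equiv> renewal_kernel l b"

lemma \<phi>_nonneg: "0 \<le> \<phi> j"
  using l_pos b_nonneg[of j] by (simp add: renewal_kernel_def)

lemma \<phi>_0: "\<phi> 0 = 0" by (simp add: renewal_kernel_def)

lemma z_nonneg: "0 \<le> z n"
proof (induction n rule: less_induct)
  case (less n)
  thus ?case using l_pos b_nonneg
    by (cases n) (auto intro!: mult_nonneg_nonneg sum_nonneg)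
qed

lemma z_ge_kernel: "\<phi> n \<le> z n"
proof (cases "n = 0")
  case False
  have "z 0 * \<phi> (n - 0) \<le> (\<Sum>i\<le>n. z i * \<phi> (n - i))"
    by (rule member_le_sum) (auto intro: mult_nonneg_nonneg z_nonneg \<phi>_nonneg)
  thus ?thesis using False by (simp add: arch_z_renewal)
qed (simp add: \<phi>_0)

lemma \<phi>_summable_iff: "summable (\<lambda>j. \<phi> j / r ^ j) \<longleftrightarrow> summable (\<lambda>j. b (Suc j) / r ^ Suc j)"
proof -
  have "summable (\<lambda>j. \<phi> j / r ^ j) \<longleftrightarrow> summable (\<lambda>j. l * (b (Suc j) / r ^ Suc j))"
    by (subst summable_Suc_iff[symmetric]) (simp add: renewal_kernel_def)
  thus ?thesis using l_pos by (simp add: summable_cmult_iff del: power_Suc times_divide_eq_right)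
qed

lemma \<phi>_suminf:
  assumes "summable (\<lambda>j. b (Suc j) / r ^ Suc j)"
  shows "(\<Sum>j. \<phi> j / r ^ j) = l * (\<Sum>j. b (Suc j) / r ^ Suc j)"
proof -
  have "(\<Sum>j. \<phi> j / r ^ j) = (\<Sum>j. \<phi> (Suc j) / r ^ Suc j)"
    using suminf_split_head[of "\<lambda>j. \<phi> j / r ^ j"] assms
    by (simp add: \<phi>_summable_iff \<phi>_0 del: power_Suc)
  also have "\<dots> = (\<Sum>j. l * (b (Suc j) / r ^ Suc j))"
    by (simp add: renewal_kernel_def)
  also have "\<dots> = l * (\<Sum>j. b (Suc j) / r ^ Suc j)"
    by (rule suminf_mult[OF assms])
  finally show ?thesis .
qed

text \<open>
  The partial sums \<open>S\<close> of \<open>z\<close> satisfy \<open>S \<le> 1 + S * suminf \<phi>\<close>.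
\<close>

lemma z_summable:
  assumes "summable \<phi>" "suminf \<phi> < 1"
  shows "summable z"
proof (rule summableI_nonneg_bounded)
  fix m
  have bd: "(\<Sum>n<k. \<phi> n) \<le> suminf \<phi>" for k
    by (rule sum_le_suminf) (use assms \<phi>_nonneg in auto)
  have "(\<Sum>n<m. z n) \<le> (\<Sum>n<m. (if n = 0 then 1 else 0) + (\<Sum>i\<le>n. z i * \<phi> (n - i)))"
    by (rule sum_mono) (simp add: arch_z_renewal)
  also have "\<dots> \<le> 1 + (\<Sum>n<m. \<Sum>i\<le>n. z i * \<phi> (n - i))"
    by (simp add: sum.distrib)
  also have "(\<Sum>n<m. \<Sum>i\<le>n. z i * \<phi> (n - i)) \<le> (\<Sum>n<m. z n) * (\<Sum>n<m. \<phi> n)"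
    by (rule sum_convolution_le[OF z_nonneg \<phi>_nonneg])
  also have "\<dots> \<le> (\<Sum>n<m. z n) * suminf \<phi>"
    by (intro mult_left_mono bd sum_nonneg z_nonneg)
  finally have "(\<Sum>n<m. z n) * (1 - suminf \<phi>) \<le> 1" by (simp add: algebra_simps)
  thus "(\<Sum>n<m. z n) \<le> 1 / (1 - suminf \<phi>)" using assms by (simp add: field_simps)
qed (rule z_nonneg)

lemma summable_z_products:
  assumes "summable z"
  shows "summable (\<lambda>i. z i * z (i + n))"
proof (rule summable_comparison_test'[of "\<lambda>i. z i * suminf z" 0])
  show "summable (\<lambda>i. z i * suminf z)" using assms by (rule summable_mult2)
  fix i :: nat
  have "z (i + n) \<le> suminf z" using sum_le_suminf[OF assms, of "{i + n}"] z_nonneg by simp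
  thus "norm (z i * z (i + n)) \<le> z i * suminf z"
    using z_nonneg by (simp add: abs_mult mult_left_mono)
qed

text \<open>
  Multiplying out the renewal equation at \<open>1 / r\<close> gives \<open>A * (1 - Q) = 1\<close> for the transforms
  \<open>A\<close> of \<open>z\<close> and \<open>Q\<close> of \<open>\<phi>\<close>.
\<close>

lemma kernel_transform_less_1:
  assumes r: "0 < r" and Z: "summable (\<lambda>n. z n / r ^ n)"
  shows "summable (\<lambda>n. \<phi> n / r ^ n)" "(\<Sum>n. \<phi> n / r ^ n) < 1"
proof -
  show S: "summable (\<lambda>n. \<phi> n / r ^ n)"
    by (rule summable_comparison_test'[OF Z, of 0])
       (use r in \<open>auto simp: \<phi>_nonneg intro!: divide_right_mono z_ge_kernel\<close>)
  define A where "A = (\<Sum>n. z n / r ^ n)"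
  define Q where "Q = (\<Sum>n. \<phi> n / r ^ n)"
  have "(\<lambda>n. \<Sum>i\<le>n. z i / r ^ i * (\<phi> (n - i) / r ^ (n - i))) sums (A * Q)"
    unfolding A_def Q_def
    by (rule Cauchy_product_sums) (use r S Z z_nonneg \<phi>_nonneg in auto)
  also have "(\<lambda>n. \<Sum>i\<le>n. z i / r ^ i * (\<phi> (n - i) / r ^ (n - i)))
      = (\<lambda>n. (\<Sum>i\<le>n. z i * \<phi> (n - i)) / r ^ n)"
    by (auto simp: sum_divide_distrib power_add[symmetric] intro!: ext sum.cong)
  finally have *: "(\<lambda>n. (if n = 0 then 0 else z n) / r ^ n) sums (A * Q)"
    by (simp add: arch_z_renewal)
  have "(\<lambda>n. z n / r ^ n) sums A" using Z by (simp add: A_def summable_sums)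
  from sums_diff[OF this *] have s1: "(\<lambda>n. if n = 0 then 1 else 0) sums (A - A * Q)"
    by (rule sums_cong[THEN iffD1, rotated]) auto
  have s2: "(\<lambda>n. if n = 0 then 1 else 0 :: real) sums 1"
    using sums_single[of 0 "\<lambda>_. 1 :: real"] by simp
  have "A * (1 - Q) = 1" using sums_unique2[OF s1 s2] by (simp add: algebra_simps)
  moreover have "0 \<le> A" unfolding A_def by (rule suminf_nonneg) (use Z r z_nonneg in auto)
  ultimately have "0 < 1 - Q" by (metis mult_nonneg_nonpos not_le zero_less_one)
  thus "(\<Sum>n. \<phi> n / r ^ n) < 1" by (simp add: Q_def)
qed

end

lemma weight_shift_limit:
  fixes \<gamma> :: "nat \<Rightarrow> real"
  assumes pos: "\<And>n. 0 < \<gamma> n" and lim: "(\<lambda>n. \<gamma> n / \<gamma> (Suc n)) \<longlonglongrightarrow> c"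
  shows "(\<lambda>n. \<gamma> (n - j) / \<gamma> n) \<longlonglongrightarrow> c ^ j"
proof (rule LIMSEQ_offset[of _ j])
  show "(\<lambda>n. \<gamma> (n + j - j) / \<gamma> (n + j)) \<longlonglongrightarrow> c ^ j"
  proof (induction j)
    case (Suc j)
    have "(\<lambda>n. \<gamma> (n + j) / \<gamma> (Suc (n + j))) \<longlonglongrightarrow> c"
      using LIMSEQ_ignore_initial_segment[OF lim] .
    from tendsto_mult[OF Suc this] show ?case using pos
      by (simp add: less_imp_neq[THEN not_sym] mult.commute)
  qed (use pos in \<open>simp add: less_imp_neq[THEN not_sym]\<close>)
qed

lemma weight_middle_small:
  assumes g: "\<gamma> \<in> weight_class r" and \<eta>: "0 < (\<eta>::real)"
  obtains m where "1 \<le> m"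
    "eventually (\<lambda>n. (\<Sum>i=m..n - m. \<gamma> (n - i) * \<gamma> i) \<le> \<eta> * \<gamma> n) sequentially"
proof -
  have pos: "0 < \<gamma> n" for n using g by (simp add: weight_class_def)
  have "(\<lambda>m. limsup (\<lambda>n. ereal ((1 / \<gamma> n) * (\<Sum>i=m..n - m. \<gamma> (n - i) * \<gamma> i)))) \<longlonglongrightarrow> 0"
    using g by (simp add: weight_class_def)
  hence "eventually (\<lambda>m. limsup (\<lambda>n. ereal ((1 / \<gamma> n) * (\<Sum>i=m..n - m. \<gamma> (n - i) * \<gamma> i))) < ereal \<eta>) sequentially"
    by (rule order_tendstoD) (use \<eta> in simp)
  hence "eventually (\<lambda>m. 1 \<le> m \<and> limsup (\<lambda>n. ereal ((1 / \<gamma> n) * (\<Sum>i=m..n - m. \<gamma> (n - i) * \<gamma> i))) < ereal \<eta>) sequentially"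
    by (intro eventually_conj eventually_ge_at_top)
  then obtain m where m: "1 \<le> m"
    "limsup (\<lambda>n. ereal ((1 / \<gamma> n) * (\<Sum>i=m..n - m. \<gamma> (n - i) * \<gamma> i))) < ereal \<eta>"
    by (metis (mono_tags, lifting) eventually_sequentially le_refl)
  have "eventually (\<lambda>n. ereal ((1 / \<gamma> n) * (\<Sum>i=m..n - m. \<gamma> (n - i) * \<gamma> i)) < ereal \<eta>) sequentially"
    using Limsup_lessD[OF m(2)] .
  hence "eventually (\<lambda>n. (\<Sum>i=m..n - m. \<gamma> (n - i) * \<gamma> i) \<le> \<eta> * \<gamma> n) sequentially"
  proof eventually_elim
    case (elim n)
    thus ?case using pos[of n] by (simp add: field_simps)
  qed
  thus ?thesis using that m by blast
qed

context renewal
begin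

text \<open>
  In \<open>z n = (\<Sum>i\<le>n. z i * \<phi> (n - i))\<close> with large \<open>n\<close> the range of summation is cut at \<open>m\<close> and
  \<open>n - m\<close>. The indices below \<open>m\<close> contribute at most a constant multiple of \<open>\<gamma> n\<close>. If
  \<open>z i \<le> M * \<gamma> i\<close> holds for all \<open>i < n\<close>, the indices above \<open>n - m\<close> contribute at most about
  \<open>M * \<gamma> n * \<theta>\<close>, where \<open>\<theta> < 1\<close> is the transform of \<open>\<phi>\<close>, as \<open>\<gamma> (n - j) / \<gamma> n\<close> tends to
  \<open>r\<close> to the power \<open>- j\<close>, and the indices in between at most a small multiple of \<open>M * \<gamma> n\<close> by the
  last defining property of the weight class. Since the total factor in front of \<open>M\<close> stays below
  \<open>1\<close>, the bound propagates by induction if \<open>M\<close> is large.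
\<close>

lemma z_le_weight:
  assumes r: "0 < r" and g: "\<gamma> \<in> weight_class r"
    and S: "summable (\<lambda>n. \<phi> n / r ^ n)" and S1: "(\<Sum>n. \<phi> n / r ^ n) < 1"
    and C: "0 < C" "\<And>n. 1 \<le> n \<Longrightarrow> \<phi> n \<le> C * \<gamma> n"
  shows "\<exists>K>0. \<forall>n. z n \<le> K * \<gamma> n"
proof -
  have pos: "0 < \<gamma> n" for n using g by (simp add: weight_class_def)
  have shift: "(\<lambda>n. \<gamma> (n - j) / \<gamma> n) \<longlonglongrightarrow> (1 / r) ^ j" for j
    by (rule weight_shift_limit) (use g in \<open>auto simp: weight_class_def\<close>)
  define \<theta> where "\<theta> = (\<Sum>n. \<phi> n / r ^ n)"
  (* \<eta> is so small that the factor q in front of M below stays under 1. *)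
  define \<eta> where "\<eta> = (1 - \<theta>) / (3 * (1 + C))"
  have \<eta>: "0 < \<eta>" using S1 C by (auto simp: \<eta>_def \<theta>_def)
  have small: "\<theta> + \<eta> + C * \<eta> < 1"
  proof -
    have "3 * (1 + C) * \<eta> = 1 - \<theta>" using C(1) by (simp add: \<eta>_def field_simps)
    thus ?thesis using S1 by (simp add: \<theta>_def[symmetric] algebra_simps)
  qed
  define q where "q = \<theta> + \<eta> + C * \<eta>"
  obtain m where m: "1 \<le> m"
    "eventually (\<lambda>n. (\<Sum>i=m..n - m. \<gamma> (n - i) * \<gamma> i) \<le> \<eta> * \<gamma> n) sequentially"
    using weight_middle_small[OF g \<eta>] by blast
  have "(\<lambda>n. \<Sum>j<m. \<phi> j * (\<gamma> (n - j) / \<gamma> n)) \<longlonglongrightarrow> (\<Sum>j<m. \<phi> j * (1 / r) ^ j)"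
    by (intro tendsto_sum tendsto_mult tendsto_const shift)
  moreover have "(\<Sum>j<m. \<phi> j * (1 / r) ^ j) \<le> \<theta>"
    unfolding \<theta>_def using sum_le_suminf[OF S, of "{..<m}"] \<phi>_nonneg r
    by (simp add: power_divide)
  ultimately have ev1: "eventually (\<lambda>n. (\<Sum>j<m. \<phi> j * (\<gamma> (n - j) / \<gamma> n)) < \<theta> + \<eta>) sequentially"
    using \<eta> by (intro order_tendstoD) auto
  define K where "K = C * (\<Sum>i<m. (1 / r) ^ i * z i) + 1"
  have "(\<lambda>n. C * (\<Sum>i<m. \<gamma> (n - i) / \<gamma> n * z i)) \<longlonglongrightarrow> C * (\<Sum>i<m. (1 / r) ^ i * z i)"
    by (intro tendsto_sum tendsto_mult tendsto_const shift)
  hence ev2: "eventually (\<lambda>n. C * (\<Sum>i<m. \<gamma> (n - i) / \<gamma> n * z i) < K) sequentially"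
    by (rule order_tendstoD) (simp add: K_def)
  have K0: "0 < K" using C r by (auto simp: K_def intro!: add_nonneg_pos mult_nonneg_nonneg sum_nonneg z_nonneg)
  from eventually_conj[OF m(2) eventually_conj[OF ev1 ev2]]
  obtain N where N: "\<And>n. N \<le> n \<Longrightarrow> (\<Sum>i=m..n - m. \<gamma> (n - i) * \<gamma> i) \<le> \<eta> * \<gamma> n \<and>
     (\<Sum>j<m. \<phi> j * (\<gamma> (n - j) / \<gamma> n)) < \<theta> + \<eta> \<and> C * (\<Sum>i<m. \<gamma> (n - i) / \<gamma> n * z i) < K"
    unfolding eventually_sequentially by blast
  (* K / (1 - q) is the fixed point of M \<mapsto> K + q * M; the sum takes care of the small indices. *)
  define M where "M = K / (1 - q) + (\<Sum>n<N + 2 * m. z n / \<gamma> n)"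
  have q1: "q < 1" using small by (simp add: q_def)
  have M1: "K / (1 - q) \<le> M" using pos by (auto simp: M_def intro!: sum_nonneg divide_nonneg_pos z_nonneg)
  have M0: "0 < M" using M1 K0 q1 by (smt (verit) divide_pos_pos)
  have "z n \<le> M * \<gamma> n" for n
  proof (induction n rule: less_induct)
    case (less n)
    show ?case
    proof (cases "n < N + 2 * m")
      case True
      have "z n / \<gamma> n \<le> (\<Sum>n<N + 2 * m. z n / \<gamma> n)"
        by (rule member_le_sum) (use True pos in \<open>auto intro!: divide_nonneg_pos z_nonneg\<close>)
      also have "\<dots> \<le> M" using K0 q1 by (simp add: M_def)
      finally show ?thesis using pos[of n] by (simp add: field_simps)
    next
      case False
      hence n: "N \<le> n" "2 * m \<le> n" "n \<noteq> 0" using m by auto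
      note Nn = N[OF n(1)]
      have split: "{..n} = {..<m} \<union> ({m..n - m} \<union> (\<lambda>j. n - j) ` {..<m})"
      proof (intro equalityI subsetI)
        fix i assume "i \<in> {..n}"
        moreover have "i \<in> (\<lambda>j. n - j) ` {..<m}" if "n - m < i" "i \<le> n"
          by (rule image_eqI[of _ _ "n - i"]) (use that n in auto)
        ultimately show "i \<in> {..<m} \<union> ({m..n - m} \<union> (\<lambda>j. n - j) ` {..<m})"
          by (cases "i < m"; cases "n - m < i") auto
      qed (use n in auto)
      have inj: "inj_on (\<lambda>j. n - j) {..<m}" using n by (auto simp: inj_on_def)
      have "z n = (\<Sum>i\<le>n. z i * \<phi> (n - i))" using n by (simp add: arch_z_renewal)
      also have "\<dots> = (\<Sum>i<m. z i * \<phi> (n - i)) + ((\<Sum>i=m..n - m. z i * \<phi> (n - i)) +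
          (\<Sum>j<m. z (n - j) * \<phi> (n - (n - j))))"
        unfolding split using n m
        by (subst sum.union_disjoint, simp, simp, force,
            subst sum.union_disjoint, simp, simp, force) (simp add: sum.reindex[OF inj])
      also have "(\<Sum>i<m. z i * \<phi> (n - i)) \<le> K * \<gamma> n"
      proof -
        have "(\<Sum>i<m. z i * \<phi> (n - i)) \<le> (\<Sum>i<m. z i * (C * \<gamma> (n - i)))"
          using n by (intro sum_mono mult_left_mono C z_nonneg) auto
        also have "\<dots> = C * (\<Sum>i<m. \<gamma> (n - i) / \<gamma> n * z i) * \<gamma> n"
          using pos[of n] by (simp add: sum_distrib_left sum_distrib_right mult_ac)
        also have "\<dots> \<le> K * \<gamma> n" using Nn pos[of n] by (intro mult_right_mono) auto
        finally show ?thesis .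
      qed
      also have "(\<Sum>i=m..n - m. z i * \<phi> (n - i)) \<le> (C * \<eta> * M) * \<gamma> n"
      proof -
        have "(\<Sum>i=m..n - m. z i * \<phi> (n - i)) \<le> (\<Sum>i=m..n - m. (M * \<gamma> i) * (C * \<gamma> (n - i)))"
          using n m pos C M0
          by (intro sum_mono mult_mono less.IH C z_nonneg \<phi>_nonneg mult_nonneg_nonneg)
             (auto simp: less_imp_le)
        also have "\<dots> = M * C * (\<Sum>i=m..n - m. \<gamma> (n - i) * \<gamma> i)"
          by (simp add: sum_distrib_left mult_ac)
        also have "\<dots> \<le> M * C * (\<eta> * \<gamma> n)"
          using Nn M0 C by (intro mult_left_mono) auto
        finally show ?thesis by (simp add: mult_ac)
      qed
      also have "(\<Sum>j<m. z (n - j) * \<phi> (n - (n - j))) \<le> ((\<theta> + \<eta>) * M) * \<gamma> n"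
      proof -
        have "(\<Sum>j<m. z (n - j) * \<phi> (n - (n - j))) \<le> (\<Sum>j<m. \<phi> j * (M * \<gamma> (n - j)))"
        proof (rule sum_mono)
          fix j assume j: "j \<in> {..<m}"
          show "z (n - j) * \<phi> (n - (n - j)) \<le> \<phi> j * (M * \<gamma> (n - j))"
          proof (cases "j = 0")
            case False
            hence "z (n - j) \<le> M * \<gamma> (n - j)" using n j by (intro less.IH) auto
            moreover have "n - (n - j) = j" using n j by auto
            ultimately show ?thesis using \<phi>_nonneg[of j]
              by (simp add: mult.commute mult_left_mono)
          qed (simp add: \<phi>_0)
        qed
        also have "\<dots> = (\<Sum>j<m. \<phi> j * (\<gamma> (n - j) / \<gamma> n)) * M * \<gamma> n"
          using pos[of n] by (simp add: sum_distrib_left sum_distrib_right mult_ac)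
        also have "\<dots> \<le> (\<theta> + \<eta>) * M * \<gamma> n" using Nn pos[of n] M0 by (intro mult_right_mono) auto
        finally show ?thesis .
      qed
      finally have "z n \<le> (K + q * M) * \<gamma> n" by (simp add: q_def algebra_simps)
      also have "K + q * M \<le> M" using M1 q1 by (simp add: field_simps)
      finally show ?thesis using pos[of n] by (simp add: mult_right_mono)
    qed
  qed
  thus ?thesis using M0 by blast
qed

text \<open>
  As \<open>z 0 = 1\<close>, the value \<open>z n\<close> is itself a term of the series for \<open>R n\<close>, so that bounds for
  \<open>R\<close> pass to \<open>z\<close>. In the other direction the monotone sequence \<open>\<delta>\<close> equivalent to \<open>\<gamma>\<close> turns
  \<open>z (i + n) \<le> K * \<gamma> (i + n)\<close> into a bound by a multiple of \<open>\<gamma> n\<close> that is uniform in \<open>i\<close>.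
\<close>

lemma autocorrelation_weight_iff:
  assumes r: "0 < r" and g: "\<gamma> \<in> weight_class_down r" and zs: "summable z" and s: "0 < s"
    and R: "\<And>n. R n = s * (\<Sum>i. z i * z (i + n))"
  shows "(summable (\<lambda>j. b (Suc j) / r ^ Suc j) \<and> l * (\<Sum>j. b (Suc j) / r ^ Suc j) < 1 \<and>
           (\<exists>C>0. \<forall>n\<ge>1. b n \<le> C * \<gamma> n)) \<longleftrightarrow> (\<exists>C>0. \<forall>n. R n \<le> C * \<gamma> n)"
    (is "?A \<longleftrightarrow> ?B")
proof
  have g': "\<gamma> \<in> weight_class r" using g by (simp add: weight_class_down_def)
  have pos: "0 < \<gamma> n" for n using g' by (simp add: weight_class_def)
  note zz = summable_z_products[OF zs]
  {
    assume ?A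
    then obtain C where C: "0 < C" "\<And>n. 1 \<le> n \<Longrightarrow> b n \<le> C * \<gamma> n" and
      S: "summable (\<lambda>j. b (Suc j) / r ^ Suc j)" "l * (\<Sum>j. b (Suc j) / r ^ Suc j) < 1" by blast
    have \<phi>C: "\<phi> n \<le> (l * C) * \<gamma> n" if "1 \<le> n" for n
      using C(2)[OF that] l_pos that by (simp add: renewal_kernel_def mult.assoc)
    have "summable (\<lambda>n. \<phi> n / r ^ n)" "(\<Sum>n. \<phi> n / r ^ n) < 1"
      using S unfolding \<phi>_summable_iff \<phi>_suminf[OF S(1)] by auto
    from z_le_weight[OF r g' this _ \<phi>C]
    obtain K where K: "0 < K" "\<And>n. z n \<le> K * \<gamma> n"
      using l_pos C by auto
    obtain \<delta> where \<delta>: "\<And>n. 0 < \<delta> n" "decseq \<delta>" "(\<lambda>n. \<gamma> n / \<delta> n) \<longlonglongrightarrow> 1"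
      using g by (auto simp: weight_class_down_def)
    have \<delta>': "(\<lambda>n. \<delta> n / \<gamma> n) \<longlonglongrightarrow> 1"
      using tendsto_inverse[OF \<delta>(3)] by (simp add: inverse_eq_divide)
    obtain D1 where D1: "0 < D1" "\<And>n. \<bar>\<gamma> n / \<delta> n\<bar> \<le> D1"
      using convergent_imp_Bseq[OF convergentI[OF \<delta>(3)]] unfolding Bseq_def real_norm_def by blast
    obtain D2 where D2: "0 < D2" "\<And>n. \<bar>\<delta> n / \<gamma> n\<bar> \<le> D2"
      using convergent_imp_Bseq[OF convergentI[OF \<delta>']] unfolding Bseq_def real_norm_def by blast
    have gd: "\<gamma> n \<le> D1 * \<delta> n" for n
      using D1(2)[of n] pos[of n] \<delta>(1)[of n] by (simp add: field_simps)
    have dg: "\<delta> n \<le> D2 * \<gamma> n" for n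
      using D2(2)[of n] pos[of n] \<delta>(1)[of n] by (simp add: field_simps)
    have mono: "\<gamma> (i + n) \<le> D1 * D2 * \<gamma> n" for i n
    proof -
      have "\<gamma> (i + n) \<le> D1 * \<delta> (i + n)" by (rule gd)
      also have "\<dots> \<le> D1 * \<delta> n" using D1 \<delta>(2) by (intro mult_left_mono) (auto simp: decseq_def)
      also have "\<dots> \<le> D1 * (D2 * \<gamma> n)" using D1 dg by (intro mult_left_mono) auto
      finally show ?thesis by (simp add: mult.assoc)
    qed
    have "R n \<le> (s * (K * D1 * D2 * suminf z)) * \<gamma> n" for n
    proof -
      have "(\<Sum>i. z i * z (i + n)) \<le> (\<Sum>i. z i * (K * D1 * D2 * \<gamma> n))"
      proof (rule suminf_le)
        fix i
        have "z (i + n) \<le> K * \<gamma> (i + n)" by (rule K)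
        also have "\<dots> \<le> K * (D1 * D2 * \<gamma> n)" using K mono by (intro mult_left_mono) auto
        finally show "z i * z (i + n) \<le> z i * (K * D1 * D2 * \<gamma> n)"
          using z_nonneg by (intro mult_left_mono) (auto simp: mult.assoc)
      qed (use zz zs in \<open>auto intro: summable_mult2\<close>)
      also have "\<dots> = suminf z * (K * D1 * D2 * \<gamma> n)" by (rule suminf_mult2[OF zs, symmetric])
      finally show ?thesis unfolding R using s
        by (simp add: mult_ac mult_left_mono)
    qed
    moreover have "1 \<le> suminf z" using sum_le_suminf[OF zs, of "{0}"] z_nonneg by simp
    ultimately show ?B using s K D1 D2 by (intro exI[of _ "s * (K * D1 * D2 * suminf z)"]) auto
  }
  {
    assume ?B
    then obtain C where C: "0 < C" "\<And>n. R n \<le> C * \<gamma> n" by blast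
    have zg: "z n \<le> C / s * \<gamma> n" for n
    proof -
      have "z 0 * z (0 + n) \<le> (\<Sum>i. z i * z (i + n))"
        using sum_le_suminf[OF zz[of n], of "{0}"] z_nonneg by simp
      hence "s * z n \<le> R n" unfolding R using s by (intro mult_left_mono) auto
      also note C(2)
      finally show ?thesis using s by (simp add: field_simps)
    qed
    have "summable (\<lambda>n. \<gamma> n / r ^ n)" using g' by (simp add: weight_class_def)
    hence "summable (\<lambda>n. C / s * (\<gamma> n / r ^ n))" by (rule summable_mult)
    hence Z: "summable (\<lambda>n. z n / r ^ n)"
    proof (rule summable_comparison_test'[of _ 0])
      fix n
      have "z n / r ^ n \<le> C / s * \<gamma> n / r ^ n"
        by (rule divide_right_mono[OF zg]) (use r in simp)
      thus "norm (z n / r ^ n) \<le> C / s * (\<gamma> n / r ^ n)" using r z_nonneg by simp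
    qed
    have "b n \<le> C / s / l * \<gamma> n" if "1 \<le> n" for n
    proof -
      have "b n * l \<le> C / s * \<gamma> n"
        using z_ge_kernel[of n] zg[of n] that by (simp add: renewal_kernel_def mult.commute)
      hence "b n \<le> C / s * \<gamma> n / l" using l_pos by (simp only: pos_le_divide_eq)
      thus ?thesis by simp
    qed
    moreover have "0 < C / s / l" using C s l_pos by simp
    ultimately show ?A
      using kernel_transform_less_1[OF r Z] \<phi>_suminf[of r] unfolding \<phi>_summable_iff by metis
  }
qed

end

section \<open>Square-integrable functions and random series\<close>

definition square_integrable :: "'w measure \<Rightarrow> ('w \<Rightarrow> real) \<Rightarrow> bool" where
  "square_integrable M f \<longleftrightarrow> f \<in> borel_measurable M \<and> integrable M (\<lambda>\<omega>. (f \<omega>)\<^sup>2)"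

lemma square_integrable_measurable [measurable_dest]:
  "square_integrable M f \<Longrightarrow> f \<in> borel_measurable M"
  by (simp add: square_integrable_def)

lemma square_integrable_cong_AE:
  assumes "square_integrable M f" "g \<in> borel_measurable M" "AE \<omega> in M. f \<omega> = g \<omega>"
  shows "square_integrable M g"
  using assms unfolding square_integrable_def
  by (auto intro: integrable_cong_AE_imp)

lemma square_integrable_prod:
  assumes "square_integrable M f" "square_integrable M g"
  shows "integrable M (\<lambda>\<omega>. f \<omega> * g \<omega>)"
proof (rule Bochner_Integration.integrable_bound)
  show "integrable M (\<lambda>\<omega>. (f \<omega>)\<^sup>2 + (g \<omega>)\<^sup>2)"
    using assms by (auto simp: square_integrable_def)
  have "\<bar>x * y\<bar> \<le> x\<^sup>2 + y\<^sup>2" for x y :: real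
  proof -
    have "2 * \<bar>x\<bar> * \<bar>y\<bar> \<le> x\<^sup>2 + y\<^sup>2" using sum_squares_bound[of "\<bar>x\<bar>" "\<bar>y\<bar>"] by simp
    moreover have "0 \<le> \<bar>x\<bar> * \<bar>y\<bar>" by simp
    ultimately show ?thesis unfolding abs_mult by linarith
  qed
  thus "AE \<omega> in M. norm (f \<omega> * g \<omega>) \<le> norm ((f \<omega>)\<^sup>2 + (g \<omega>)\<^sup>2)" by simp
qed (use assms in \<open>auto simp: square_integrable_def\<close>)

lemma square_integrable_add:
  assumes "square_integrable M f" "square_integrable M g"
  shows "square_integrable M (\<lambda>\<omega>. f \<omega> + g \<omega>)"
  using assms square_integrable_prod[OF assms] unfolding square_integrable_def power2_sum
  by (auto simp: mult.assoc)

lemma square_integrable_cmult: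
  assumes "square_integrable M f"
  shows "square_integrable M (\<lambda>\<omega>. c * f \<omega>)"
  using assms unfolding square_integrable_def power_mult_distrib by auto

lemma square_integrable_sum:
  assumes "\<And>i. i \<in> I \<Longrightarrow> square_integrable M (f i)"
  shows "square_integrable M (\<lambda>\<omega>. \<Sum>i\<in>I. f i \<omega>)"
  using assms
  by (induction I rule: infinite_finite_induct)
     (auto simp: square_integrable_add, auto simp: square_integrable_def)

text \<open>
  The integral of \<open>(\<bar>f\<bar> - t * \<bar>g\<bar>)\<^sup>2\<close> is a quadratic polynomial in \<open>t\<close> that is nowhere negative.
\<close>

lemma integral_Cauchy_Schwarz:
  assumes f: "square_integrable M f" and g: "square_integrable M g"
  shows "(\<integral>\<omega>. \<bar>f \<omega> * g \<omega>\<bar> \<partial>M) \<le> sqrt (\<integral>\<omega>. (f \<omega>)\<^sup>2 \<partial>M) * sqrt (\<integral>\<omega>. (g \<omega>)\<^sup>2 \<partial>M)"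
proof -
  define A where "A = (\<integral>\<omega>. (f \<omega>)\<^sup>2 \<partial>M)"
  define B where "B = (\<integral>\<omega>. (g \<omega>)\<^sup>2 \<partial>M)"
  define P where "P = (\<integral>\<omega>. \<bar>f \<omega> * g \<omega>\<bar> \<partial>M)"
  have nn: "0 \<le> A" "0 \<le> B" "0 \<le> P" by (auto simp: A_def B_def P_def)
  have [simp]: "integrable M (\<lambda>\<omega>. (f \<omega>)\<^sup>2)" "integrable M (\<lambda>\<omega>. (g \<omega>)\<^sup>2)"
    "integrable M (\<lambda>\<omega>. \<bar>f \<omega> * g \<omega>\<bar>)"
    using f g square_integrable_prod[OF f g] by (auto simp: square_integrable_def simp del: abs_mult)
  have quad: "0 \<le> A - 2 * t * P + t\<^sup>2 * B" for t
  proof -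
    have "0 \<le> (\<integral>\<omega>. (\<bar>f \<omega>\<bar> - t * \<bar>g \<omega>\<bar>)\<^sup>2 \<partial>M)" by simp
    also have "\<dots> = (\<integral>\<omega>. (f \<omega>)\<^sup>2 - 2 * t * \<bar>f \<omega> * g \<omega>\<bar> + t\<^sup>2 * (g \<omega>)\<^sup>2 \<partial>M)"
      by (intro Bochner_Integration.integral_cong refl)
         (simp add: power2_diff power_mult_distrib abs_mult algebra_simps)
    also have "\<dots> = A - 2 * t * P + t\<^sup>2 * B"
      by (simp add: A_def B_def P_def del: abs_mult)
    finally show ?thesis .
  qed
  have "P\<^sup>2 \<le> A * B"
  proof (cases "B = 0")
    case True
    have "P = 0"
    proof (rule ccontr)
      assume "P \<noteq> 0"
      thus False using quad[of "(A + 1) / (2 * P)"] True by simp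
    qed
    thus ?thesis using nn by simp
  next
    case False
    thus ?thesis using quad[of "P / B"] nn by (simp add: field_simps power2_eq_square)
  qed
  hence "P \<le> sqrt (A * B)" using nn by (intro real_le_rsqrt)
  thus ?thesis by (simp add: A_def B_def P_def real_sqrt_mult)
qed

lemma AE_summable_of_integrals:
  fixes f :: "nat \<Rightarrow> 'w \<Rightarrow> real"
  assumes f: "\<And>n. integrable M (f n)" and c: "summable c" "\<And>n. (\<integral>\<omega>. \<bar>f n \<omega>\<bar> \<partial>M) \<le> c n"
  shows "AE \<omega> in M. summable (\<lambda>n. \<bar>f n \<omega>\<bar>)"
proof -
  have [measurable]: "f n \<in> borel_measurable M" for n using f by auto
  have s: "summable (\<lambda>n. \<integral>\<omega>. \<bar>f n \<omega>\<bar> \<partial>M)"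
    by (rule summable_comparison_test'[OF c(1), of 0]) (use c(2) in auto)
  have "(\<integral>\<^sup>+\<omega>. (\<Sum>n. ennreal \<bar>f n \<omega>\<bar>) \<partial>M) = (\<Sum>n. \<integral>\<^sup>+\<omega>. ennreal \<bar>f n \<omega>\<bar> \<partial>M)"
    by (rule nn_integral_suminf) auto
  also have "\<dots> = (\<Sum>n. ennreal (\<integral>\<omega>. \<bar>f n \<omega>\<bar> \<partial>M))"
    using f by (subst nn_integral_eq_integral) auto
  also have "\<dots> \<noteq> \<infinity>" using s by (simp add: ennreal_suminf_neq_top)
  finally have "AE \<omega> in M. (\<Sum>n. ennreal \<bar>f n \<omega>\<bar>) \<noteq> \<infinity>"
    by (intro nn_integral_PInf_AE) auto
  thus ?thesis by eventually_elim (auto intro: summable_suminf_not_top)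
qed

lemma integrable_series:
  fixes f :: "nat \<Rightarrow> 'w \<Rightarrow> real"
  assumes f: "\<And>n. integrable M (f n)" and c: "summable c" "\<And>n. (\<integral>\<omega>. \<bar>f n \<omega>\<bar> \<partial>M) \<le> c n"
  shows "integrable M (\<lambda>\<omega>. \<Sum>n. f n \<omega>)" "(\<integral>\<omega>. (\<Sum>n. f n \<omega>) \<partial>M) = (\<Sum>n. \<integral>\<omega>. f n \<omega> \<partial>M)"
proof -
  have s: "summable (\<lambda>n. \<integral>\<omega>. norm (f n \<omega>) \<partial>M)"
    by (rule summable_comparison_test'[OF c(1), of 0]) (use c(2) in auto)
  have ae: "AE \<omega> in M. summable (\<lambda>n. norm (f n \<omega>))"
    using AE_summable_of_integrals[OF assms] by simp
  show "integrable M (\<lambda>\<omega>. \<Sum>n. f n \<omega>)" "(\<integral>\<omega>. (\<Sum>n. f n \<omega>) \<partial>M) = (\<Sum>n. \<integral>\<omega>. f n \<omega> \<partial>M)"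
    by (rule integrable_suminf[OF f ae s] integral_suminf[OF f ae s])+
qed

lemma suminf_Cauchy_Schwarz:
  fixes w y :: "nat \<Rightarrow> real"
  assumes w: "\<And>n. 0 \<le> w n" "summable w" and y: "summable (\<lambda>n. w n * y n)"
    and y2: "summable (\<lambda>n. w n * (y n)\<^sup>2)"
  shows "(\<Sum>n. w n * y n)\<^sup>2 \<le> suminf w * (\<Sum>n. w n * (y n)\<^sup>2)"
proof (rule LIMSEQ_le_const2)
  show "(\<lambda>m. (\<Sum>n<m. w n * y n)\<^sup>2) \<longlonglongrightarrow> (\<Sum>n. w n * y n)\<^sup>2"
    by (intro tendsto_power summable_LIMSEQ y)
  have "(\<Sum>n<m. w n * y n)\<^sup>2 \<le> suminf w * (\<Sum>n. w n * (y n)\<^sup>2)" for m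
  proof -
    have "(\<Sum>n<m. sqrt (w n) * (sqrt (w n) * y n))\<^sup>2
        \<le> (\<Sum>n<m. (sqrt (w n))\<^sup>2) * (\<Sum>n<m. (sqrt (w n) * y n)\<^sup>2)"
      by (rule Cauchy_Schwarz_ineq_sum)
    also have "(\<Sum>n<m. sqrt (w n) * (sqrt (w n) * y n)) = (\<Sum>n<m. w n * y n)"
      using w by (simp add: mult.assoc[symmetric])
    also have "(\<Sum>n<m. (sqrt (w n))\<^sup>2) * (\<Sum>n<m. (sqrt (w n) * y n)\<^sup>2)
        = (\<Sum>n<m. w n) * (\<Sum>n<m. w n * (y n)\<^sup>2)"
      using w by (simp add: power_mult_distrib)
    also have "\<dots> \<le> suminf w * (\<Sum>n. w n * (y n)\<^sup>2)"
      using w by (intro mult_mono sum_le_suminf w y2 suminf_nonneg sum_nonneg) auto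
    finally show ?thesis .
  qed
  thus "\<exists>N. \<forall>m\<ge>N. (\<Sum>n<m. w n * y n)\<^sup>2 \<le> suminf w * (\<Sum>n. w n * (y n)\<^sup>2)" by blast
qed

lemma (in prob_space) square_integrable_const: "square_integrable M (\<lambda>_. c)"
  by (simp add: square_integrable_def)

lemma (in prob_space) square_integrable_imp_integrable:
  assumes "square_integrable M f"
  shows "integrable M f"
  using square_integrable_prod[OF assms square_integrable_const[of 1]] by simp

lemma (in prob_space) expectation_square_add_le:
  assumes f: "square_integrable M f" and g: "square_integrable M g"
  shows "expectation (\<lambda>\<omega>. (f \<omega> + g \<omega>)\<^sup>2)
    \<le> 2 * expectation (\<lambda>\<omega>. (f \<omega>)\<^sup>2) + 2 * expectation (\<lambda>\<omega>. (g \<omega>)\<^sup>2)"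
proof -
  have [simp]: "integrable M (\<lambda>\<omega>. (f \<omega>)\<^sup>2)" "integrable M (\<lambda>\<omega>. (g \<omega>)\<^sup>2)"
    "integrable M (\<lambda>\<omega>. (f \<omega> + g \<omega>)\<^sup>2)"
    using f g square_integrable_add[OF f g] by (auto simp: square_integrable_def)
  have "(x + y)\<^sup>2 \<le> 2 * x\<^sup>2 + 2 * y\<^sup>2" for x y :: real
    using sum_squares_bound[of x y] by (simp add: power2_sum)
  hence "expectation (\<lambda>\<omega>. (f \<omega> + g \<omega>)\<^sup>2) \<le> expectation (\<lambda>\<omega>. 2 * (f \<omega>)\<^sup>2 + 2 * (g \<omega>)\<^sup>2)"
    by (intro integral_mono) auto
  thus ?thesis by simp
qed

text \<open>
  By the Cauchy-Schwarz inequality for the weights \<open>w\<close>, the square of the sum is at most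
  \<open>suminf w\<close> times the weighted sum of the squares, which may be integrated term by term.
\<close>

lemma (in prob_space) square_integrable_series:
  assumes w: "\<And>n. 0 \<le> w n" "summable w"
    and Y: "\<And>n. square_integrable M (Y n)" "\<And>n. (\<integral>\<omega>. (Y n \<omega>)\<^sup>2 \<partial>M) \<le> K"
  shows "AE \<omega> in M. summable (\<lambda>n. w n * \<bar>Y n \<omega>\<bar>)"
    and "square_integrable M (\<lambda>\<omega>. \<Sum>n. w n * Y n \<omega>)"
    and "(\<integral>\<omega>. (\<Sum>n. w n * Y n \<omega>)\<^sup>2 \<partial>M) \<le> (suminf w)\<^sup>2 * K"
proof -
  have [measurable]: "Y n \<in> borel_measurable M" for n using Y(1) by (rule square_integrable_measurable)
  have i2: "integrable M (\<lambda>\<omega>. (Y n \<omega>)\<^sup>2)" for n using Y by (simp add: square_integrable_def)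
  have i1: "integrable M (Y n)" for n using Y(1) by (rule square_integrable_imp_integrable)
  have l1: "(\<integral>\<omega>. \<bar>Y n \<omega>\<bar> \<partial>M) \<le> sqrt K" for n
    using integral_Cauchy_Schwarz[OF Y(1)[of n] square_integrable_const[of 1]] Y(2)[of n]
    by (simp add: prob_space) (meson order_trans real_sqrt_le_mono)
  have "AE \<omega> in M. summable (\<lambda>n. \<bar>w n * Y n \<omega>\<bar>)"
    by (rule AE_summable_of_integrals[where c = "\<lambda>n. w n * sqrt K"])
       (use i1 w l1 in \<open>auto simp: abs_mult intro!: summable_mult2 mult_left_mono\<close>)
  thus ae1: "AE \<omega> in M. summable (\<lambda>n. w n * \<bar>Y n \<omega>\<bar>)" using w by (simp add: abs_mult)
  have c2: "(\<integral>\<omega>. \<bar>w n * (Y n \<omega>)\<^sup>2\<bar> \<partial>M) \<le> w n * K" for n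
    using w Y(2) by (simp add: abs_mult mult_left_mono)
  have j2: "integrable M (\<lambda>\<omega>. w n * (Y n \<omega>)\<^sup>2)" for n using i2 by simp
  have s2: "summable (\<lambda>n. w n * K)" using w by (intro summable_mult2)
  have ae2: "AE \<omega> in M. summable (\<lambda>n. w n * (Y n \<omega>)\<^sup>2)"
    using AE_summable_of_integrals[OF j2 s2 c2] w by (simp add: abs_mult)
  note series = integrable_series[OF j2 s2 c2]
  have bound: "AE \<omega> in M. (\<Sum>n. w n * Y n \<omega>)\<^sup>2 \<le> suminf w * (\<Sum>n. w n * (Y n \<omega>)\<^sup>2)"
    using ae1 ae2
  proof eventually_elim
    case (elim \<omega>)
    have "summable (\<lambda>n. w n * Y n \<omega>)"
      by (rule summable_comparison_test'[OF elim(1), of 0]) (simp add: abs_mult w)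
    thus ?case by (intro suminf_Cauchy_Schwarz w elim)
  qed
  have int: "integrable M (\<lambda>\<omega>. suminf w * (\<Sum>n. w n * (Y n \<omega>)\<^sup>2))" using series by simp
  show sq: "square_integrable M (\<lambda>\<omega>. \<Sum>n. w n * Y n \<omega>)"
    unfolding square_integrable_def
  proof
    show "integrable M (\<lambda>\<omega>. (\<Sum>n. w n * Y n \<omega>)\<^sup>2)"
      by (rule Bochner_Integration.integrable_bound[OF int]) (use bound in auto)
  qed simp
  have "(\<integral>\<omega>. (\<Sum>n. w n * Y n \<omega>)\<^sup>2 \<partial>M) \<le> (\<integral>\<omega>. suminf w * (\<Sum>n. w n * (Y n \<omega>)\<^sup>2) \<partial>M)"
    using sq int bound by (intro integral_mono_AE) (auto simp: square_integrable_def)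
  also have "\<dots> = suminf w * (\<Sum>n. w n * (\<integral>\<omega>. (Y n \<omega>)\<^sup>2 \<partial>M))"
    using series by simp
  also have "\<dots> \<le> suminf w * (\<Sum>n. w n * K)"
  proof (intro mult_left_mono suminf_le suminf_nonneg w s2 Y)
    show "summable (\<lambda>n. w n * (\<integral>\<omega>. (Y n \<omega>)\<^sup>2 \<partial>M))"
      by (rule summable_comparison_test'[OF s2, of 0]) (use w Y(2) in \<open>auto simp: mult_left_mono\<close>)
  qed
  also have "\<dots> = (suminf w)\<^sup>2 * K"
    using suminf_mult2[OF w(2), of K] by (simp add: power2_eq_square)
  finally show "(\<integral>\<omega>. (\<Sum>n. w n * Y n \<omega>)\<^sup>2 \<partial>M) \<le> (suminf w)\<^sup>2 * K" .
qed

lemma integral_square_orthogonal_sum: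
  fixes f :: "nat \<Rightarrow> 'w \<Rightarrow> real"
  assumes f: "\<And>i. square_integrable M (f i)"
    and orth: "\<And>i j. i < j \<Longrightarrow> (\<integral>\<omega>. f i \<omega> * f j \<omega> \<partial>M) = 0"
  shows "(\<integral>\<omega>. (\<Sum>i\<le>n. c i * f i \<omega>)\<^sup>2 \<partial>M) = (\<Sum>i\<le>n. (c i)\<^sup>2 * (\<integral>\<omega>. (f i \<omega>)\<^sup>2 \<partial>M))"
proof -
  have [simp]: "integrable M (\<lambda>\<omega>. f i \<omega> * f j \<omega>)" for i j
    by (rule square_integrable_prod[OF f f])
  have o: "(\<integral>\<omega>. f i \<omega> * f j \<omega> \<partial>M) = (if i = j then \<integral>\<omega>. (f i \<omega>)\<^sup>2 \<partial>M else 0)" for i j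
    using orth[of i j] orth[of j i]
    by (cases i j rule: linorder_cases) (auto simp: power2_eq_square mult.commute)
  have "(\<integral>\<omega>. (\<Sum>i\<le>n. c i * f i \<omega>)\<^sup>2 \<partial>M) = (\<integral>\<omega>. (\<Sum>i\<le>n. \<Sum>j\<le>n. c i * c j * (f i \<omega> * f j \<omega>)) \<partial>M)"
    by (simp add: power2_eq_square sum_product mult_ac)
  also have "\<dots> = (\<Sum>i\<le>n. \<Sum>j\<le>n. c i * c j * (\<integral>\<omega>. f i \<omega> * f j \<omega> \<partial>M))" by simp
  also have "\<dots> = (\<Sum>i\<le>n. \<Sum>j\<le>n. if j = i then c i * c i * (\<integral>\<omega>. (f i \<omega>)\<^sup>2 \<partial>M) else 0)"
    by (intro sum.cong refl) (simp add: o)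
  also have "\<dots> = (\<Sum>i\<le>n. (c i)\<^sup>2 * (\<integral>\<omega>. (f i \<omega>)\<^sup>2 \<partial>M))"
    by (simp add: power2_eq_square)
  finally show ?thesis .
qed

section \<open>Functions of the innovations with indices in a given set\<close>

text \<open>
  The \<open>\<sigma>\<close>-algebra generated by the variables \<open>\<xi> i\<close> with \<open>i \<in> A\<close>. Measurability with respect to it
  expresses causality and is preserved by all limits of sequences.
\<close>

definition generated_by ::
    "'w measure \<Rightarrow> (int \<Rightarrow> 'w \<Rightarrow> real) \<Rightarrow> int set \<Rightarrow> 'w measure" where
  "generated_by M \<xi> A = vimage_algebra (space M) (\<lambda>\<omega>. \<lambda>i\<in>A. \<xi> i \<omega>) (PiM A (\<lambda>_. borel))"

lemma generated_by_coordinate: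
  assumes "i \<in> A"
  shows "\<xi> i \<in> borel_measurable (generated_by M \<xi> A)"
proof -
  have "(\<lambda>\<omega>. \<lambda>i\<in>A. \<xi> i \<omega>) \<in> measurable (generated_by M \<xi> A) (PiM A (\<lambda>_. borel))"
    unfolding generated_by_def by (rule measurable_vimage_algebra1) (auto simp: space_PiM)
  from measurable_compose[OF this measurable_component_singleton[OF assms]] show ?thesis
    using assms by simp
qed

lemma measurable_generated_by_mono:
  assumes "\<And>i. i \<in> A \<Longrightarrow> \<xi> i \<in> borel_measurable N" "space N = space M"
    "f \<in> borel_measurable (generated_by M \<xi> A)"
  shows "f \<in> borel_measurable N"
proof -
  have "(\<lambda>\<omega>. \<omega>) \<in> measurable N (generated_by M \<xi> A)"
    unfolding generated_by_def using assms(1,2)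
    by (intro measurable_vimage_algebra2) auto
  from measurable_compose[OF this assms(3)] show ?thesis .
qed

lemma (in prob_space) indep_var_generated_by:
  assumes ind: "indep_vars (\<lambda>_. borel) \<xi> UNIV" and AB: "A \<inter> B = {}"
    and f: "f \<in> borel_measurable (generated_by M \<xi> A)"
    and g: "g \<in> borel_measurable (generated_by M \<xi> B)"
  shows "indep_var borel f borel g"
proof -
  have \<xi>: "\<xi> i \<in> borel_measurable M" for i using ind by (simp add: indep_vars_def)
  have "indep_var (PiM A (\<lambda>_. borel)) (\<lambda>\<omega>. \<lambda>i\<in>A. \<xi> i \<omega>) (PiM B (\<lambda>_. borel)) (\<lambda>\<omega>. \<lambda>i\<in>B. \<xi> i \<omega>)"
    by (rule indep_var_restrict[OF ind AB]) auto
  hence I: "indep_set (sets (generated_by M \<xi> A)) (sets (generated_by M \<xi> B))"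
    unfolding indep_var_eq generated_by_def sets_vimage_algebra by blast
  have sub: "sigma_sets (space M) {h -` S \<inter> space M |S. S \<in> sets borel} \<subseteq> sets (generated_by M \<xi> C)"
    if "h \<in> borel_measurable (generated_by M \<xi> C)" for h C
  proof -
    have sp: "space (generated_by M \<xi> C) = space M" by (simp add: generated_by_def)
    show ?thesis
      using sets.sigma_sets_subset[of "{h -` S \<inter> space M |S. S \<in> sets borel}" "generated_by M \<xi> C"]
        measurable_sets[OF that] unfolding sp by blast
  qed
  show ?thesis
    unfolding indep_var_eq
  proof (intro conjI)
    show "random_variable borel f" "random_variable borel g"
      using \<xi> by (auto intro: measurable_generated_by_mono[OF _ _ f] measurable_generated_by_mono[OF _ _ g])
    show "indep_set (sigma_sets (space M) {f -` S \<inter> space M |S. S \<in> sets borel})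
       (sigma_sets (space M) {g -` S \<inter> space M |S. S \<in> sets borel})"
      using I sub[OF f] sub[OF g] unfolding indep_sets2_eq by blast
  qed
qed

lemma (in prob_space) square_integrable_indep_prod:
  assumes ind: "indep_var borel f borel g"
    and f: "square_integrable M f" and g: "square_integrable M g"
  shows "square_integrable M (\<lambda>\<omega>. f \<omega> * g \<omega>)"
    and "(\<integral>\<omega>. (f \<omega> * g \<omega>)\<^sup>2 \<partial>M) = (\<integral>\<omega>. (f \<omega>)\<^sup>2 \<partial>M) * (\<integral>\<omega>. (g \<omega>)\<^sup>2 \<partial>M)"
proof -
  have "indep_var borel ((\<lambda>x. x\<^sup>2) \<circ> f) borel ((\<lambda>x. x\<^sup>2) \<circ> g)"
    by (rule indep_var_compose[OF ind]) auto
  hence i: "indep_var borel (\<lambda>\<omega>. (f \<omega>)\<^sup>2) borel (\<lambda>\<omega>. (g \<omega>)\<^sup>2)" by (simp add: o_def)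
  show "square_integrable M (\<lambda>\<omega>. f \<omega> * g \<omega>)"
    and "(\<integral>\<omega>. (f \<omega> * g \<omega>)\<^sup>2 \<partial>M) = (\<integral>\<omega>. (f \<omega>)\<^sup>2 \<partial>M) * (\<integral>\<omega>. (g \<omega>)\<^sup>2 \<partial>M)"
    using indep_var_integrable[OF i] indep_var_lebesgue_integral[OF i] f g
    by (auto simp: square_integrable_def power_mult_distrib)
qed

section \<open>Linear inversion of a stationary solution\<close>

text \<open>
  The equations only relate \<open>X\<close> to its own past, so that a solution may a priori depend on future
  innovations; excluding this is the purpose of the section on causality.
\<close>

locale arch_process = prob_space M + renewal l b for M :: "'w measure" and l b +
  fixes \<xi> X :: "int \<Rightarrow> 'w \<Rightarrow> real" and a \<sigma> :: real
  assumes indep_\<xi>: "indep_vars (\<lambda>_. borel) \<xi> UNIV"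
    and distr_\<xi>: "distr M borel (\<xi> k) = distr M borel (\<xi> 0)"
    and \<xi>_square: "integrable M (\<lambda>\<omega>. (\<xi> 0 \<omega>)\<^sup>2)"
    and l_eq: "l = expectation (\<xi> 0)"
    and \<sigma>_eq: "\<sigma> = sqrt (variance (\<xi> 0))" and \<sigma>_pos: "0 < \<sigma>"
    and a_pos: "0 < a"
    and b_summable: "summable (\<lambda>j. b (Suc j))" and mass_b: "l * (\<Sum>j. b (Suc j)) < 1"
    and Omega: "arch_Omega l \<sigma> b < 1"
    and solution: "arch_solution M a b \<xi> X"
    and stationary: "weakly_stationary M X"
begin

abbreviation vol :: "int \<Rightarrow> 'w \<Rightarrow> real" where "vol \<equiv> arch_volatility a b X"

definition \<epsilon> :: "int \<Rightarrow> 'w \<Rightarrow> real" where "\<epsilon> k \<omega> = \<xi> k \<omega> - l"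
definition \<nu> :: "int \<Rightarrow> 'w \<Rightarrow> real" where "\<nu> k \<omega> = X k \<omega> - l * vol k \<omega>"
definition \<zeta> :: "nat \<Rightarrow> real" where "\<zeta> j = (if j = 0 then 0 else z j / l)"
definition mean_vol :: real where "mean_vol = a * suminf z"
definition moment2_X :: real where "moment2_X = expectation (\<lambda>\<omega>. (X 0 \<omega>)\<^sup>2)"

lemma \<xi>_measurable [measurable]: "\<xi> k \<in> borel_measurable M"
  using indep_\<xi> by (simp add: indep_vars_def)

lemma \<xi>_transfer:
  assumes [measurable]: "f \<in> borel_measurable borel"
  shows "integrable M (\<lambda>\<omega>. f (\<xi> k \<omega>) :: real) \<longleftrightarrow> integrable M (\<lambda>\<omega>. f (\<xi> 0 \<omega>))"
    and "(\<integral>\<omega>. f (\<xi> k \<omega>) \<partial>M) = (\<integral>\<omega>. f (\<xi> 0 \<omega>) \<partial>M :: real)"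
  using distr_\<xi>[of k] by (metis assms \<xi>_measurable integrable_distr_eq, metis assms \<xi>_measurable integral_distr)

lemma \<xi>_square_integrable: "square_integrable M (\<xi> k)"
  using \<xi>_square \<xi>_transfer(1)[of "\<lambda>x. x\<^sup>2" k] by (simp add: square_integrable_def)

lemma \<epsilon>_square_integrable: "square_integrable M (\<epsilon> k)"
  using square_integrable_add[OF \<xi>_square_integrable square_integrable_const[of "- l"]]
  by (simp add: \<epsilon>_def[abs_def])

lemma expectation_\<epsilon>: "expectation (\<epsilon> k) = 0"
proof -
  have "integrable M (\<xi> k)" by (rule square_integrable_imp_integrable[OF \<xi>_square_integrable])
  moreover have "expectation (\<xi> k) = l" using \<xi>_transfer(2)[of "\<lambda>x. x" k] l_eq by simp
  ultimately show ?thesis unfolding \<epsilon>_def[abs_def] by (simp add: prob_space)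
qed

lemma expectation_\<epsilon>_square: "expectation (\<lambda>\<omega>. (\<epsilon> k \<omega>)\<^sup>2) = \<sigma>\<^sup>2"
proof -
  have "expectation (\<lambda>\<omega>. (\<epsilon> k \<omega>)\<^sup>2) = variance (\<xi> 0)"
    unfolding \<epsilon>_def l_eq[symmetric] using \<xi>_transfer(2)[of "\<lambda>x. (x - l)\<^sup>2" k] by simp
  thus ?thesis by (simp add: \<sigma>_eq)
qed

lemma \<phi>_mass: "summable \<phi>" "suminf \<phi> < 1"
  using \<phi>_summable_iff[of 1] \<phi>_suminf[of 1] b_summable mass_b by auto

lemma z_sum: "summable z" by (rule z_summable[OF \<phi>_mass])

lemma \<zeta>_nonneg: "0 \<le> \<zeta> j" using z_nonneg l_pos by (simp add: \<zeta>_def)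

lemma \<zeta>_summable: "summable \<zeta>"
proof (rule summable_comparison_test'[of "\<lambda>j. z j / l" 0])
  show "summable (\<lambda>j. z j / l)" using z_sum by (rule summable_divide)
qed (use z_nonneg l_pos in \<open>auto simp: \<zeta>_def\<close>)

lemma X_square_integrable: "square_integrable M (X k)"
  using stationary unfolding weakly_stationary_def square_integrable_def
  by (auto intro: borel_measurable_integrable)

lemma X_second_moment: "expectation (\<lambda>\<omega>. (X k \<omega>)\<^sup>2) = moment2_X"
proof -
  define \<mu> where "\<mu> = expectation (X 0)"
  have \<mu>: "expectation (X n) = \<mu>" for n
    using stationary unfolding weakly_stationary_def \<mu>_def by blast
  have [simp]: "integrable M (X n)" "integrable M (\<lambda>\<omega>. (X n \<omega>)\<^sup>2)" for n
    using stationary unfolding weakly_stationary_def by blast+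
  have "cov M (X n) (X (n + 0)) = expectation (\<lambda>\<omega>. (X n \<omega>)\<^sup>2) - \<mu>\<^sup>2" for n
  proof -
    have "cov M (X n) (X (n + 0)) = expectation (\<lambda>\<omega>. (X n \<omega>)\<^sup>2 - 2 * \<mu> * X n \<omega> + \<mu>\<^sup>2)"
      unfolding cov_def \<mu> by (simp add: power2_eq_square algebra_simps)
    also have "\<dots> = expectation (\<lambda>\<omega>. (X n \<omega>)\<^sup>2) - 2 * \<mu> * \<mu> + \<mu>\<^sup>2"
      by (simp add: \<mu> prob_space)
    finally show ?thesis by (simp add: power2_eq_square)
  qed
  moreover have "cov M (X k) (X (k + 0)) = cov M (X 0) (X (0 + 0))"
    using stationary unfolding weakly_stationary_def by blast
  ultimately show ?thesis by (simp add: moment2_X_def)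
qed

lemma vol_bounds:
  shows vol_square_integrable: "square_integrable M (vol k)"
    and "expectation (\<lambda>\<omega>. (vol k \<omega>)\<^sup>2)
      \<le> 2 * a\<^sup>2 + 2 * ((\<Sum>j. b (Suc j))\<^sup>2 * moment2_X)"
proof -
  have S2: "square_integrable M (\<lambda>\<omega>. \<Sum>j. b (Suc j) * X (k - int (Suc j)) \<omega>)"
    "(\<integral>\<omega>. (\<Sum>j. b (Suc j) * X (k - int (Suc j)) \<omega>)\<^sup>2 \<partial>M)
      \<le> (\<Sum>j. b (Suc j))\<^sup>2 * moment2_X"
    by (rule square_integrable_series(2)[where K = moment2_X]
             square_integrable_series(3)[where K = moment2_X],
        use b_nonneg b_summable X_square_integrable X_second_moment in auto)+
  show "square_integrable M (vol k)"
    using square_integrable_add[OF square_integrable_const[of a] S2(1)]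
    unfolding arch_volatility_def[abs_def] .
  show "expectation (\<lambda>\<omega>. (vol k \<omega>)\<^sup>2)
      \<le> 2 * a\<^sup>2 + 2 * ((\<Sum>j. b (Suc j))\<^sup>2 * moment2_X)"
    using expectation_square_add_le[OF square_integrable_const[of a] S2(1)] S2(2)
    unfolding arch_volatility_def[abs_def] by (simp add: prob_space)
qed

lemma \<nu>_square_integrable: "square_integrable M (\<nu> k)"
  using square_integrable_add[OF X_square_integrable square_integrable_cmult[OF vol_square_integrable, of "- l"]]
  by (simp add: \<nu>_def[abs_def])

text \<open>
  Only boundedness is available at this stage: that the second moments of \<open>\<nu>\<close> are all equal will
  follow from causality.
\<close>

lemma \<nu>_bounded:
  obtains K where "0 \<le> K" "\<And>k. expectation (\<lambda>\<omega>. (\<nu> k \<omega>)\<^sup>2) \<le> K"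
proof -
  define V where "V = 2 * a\<^sup>2 + 2 * ((\<Sum>j. b (Suc j))\<^sup>2 * moment2_X)"
  have "expectation (\<lambda>\<omega>. (\<nu> k \<omega>)\<^sup>2) \<le> 2 * moment2_X + 2 * (l\<^sup>2 * V)" for k
  proof -
    have "expectation (\<lambda>\<omega>. (\<nu> k \<omega>)\<^sup>2) \<le> 2 * moment2_X + 2 * expectation (\<lambda>\<omega>. (- l * vol k \<omega>)\<^sup>2)"
      using expectation_square_add_le[OF X_square_integrable
          square_integrable_cmult[OF vol_square_integrable, of "- l"], of k k]
      by (simp add: \<nu>_def X_second_moment)
    also have "expectation (\<lambda>\<omega>. (- l * vol k \<omega>)\<^sup>2) = l\<^sup>2 * expectation (\<lambda>\<omega>. (vol k \<omega>)\<^sup>2)"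
      by (simp add: power_mult_distrib)
    also have "\<dots> \<le> l\<^sup>2 * V" using vol_bounds(2)[of k] by (intro mult_left_mono) (auto simp: V_def)
    finally show ?thesis by simp
  qed
  moreover have "0 \<le> moment2_X" by (simp add: moment2_X_def)
  ultimately show ?thesis using that[of "2 * moment2_X + 2 * (l\<^sup>2 * V)"] by (simp add: V_def)
qed

lemma solution_AE:
  "AE \<omega> in M. \<forall>k. summable (\<lambda>j. b (Suc j) * X (k - int (Suc j)) \<omega>) \<and> X k \<omega> = vol k \<omega> * \<xi> k \<omega>"
  using solution unfolding arch_solution_def by (subst AE_all_countable) auto

lemma \<nu>_eq: "AE \<omega> in M. \<forall>k. \<nu> k \<omega> = \<epsilon> k \<omega> * vol k \<omega>"
  using solution_AE by eventually_elim (simp add: \<nu>_def \<epsilon>_def algebra_simps)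

text \<open>
  The equations say \<open>X k - l * a - (\<Sum>i. \<phi> i * X (k - i)) = \<nu> k\<close>, and convolution with \<open>z\<close>
  inverts the operator on the left because \<open>z * \<phi>\<close> agrees with \<open>z\<close> except at \<open>0\<close>, where it vanishes.
\<close>

lemma X_inversion:
  "AE \<omega> in M. \<forall>k. (\<lambda>j. z j * \<nu> (k - int j) \<omega>) sums (X k \<omega> - l * mean_vol)"
proof -
  have "AE \<omega> in M. \<forall>k. summable (\<lambda>n. z n * \<bar>X (k - int n) \<omega>\<bar>)"
    unfolding AE_all_countable
    by (intro allI square_integrable_series(1)[where K = moment2_X])
       (auto simp: z_nonneg z_sum X_square_integrable X_second_moment)
  thus ?thesis using solution_AE
  proof eventually_elim
    case (elim \<omega>)
    show ?case
    proof
      fix k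
      define x where "x n = X (k - int n) \<omega>" for n
      have zx: "summable (\<lambda>n. z n * \<bar>x n\<bar>)" using elim(1) by (simp add: x_def)
      have \<nu>x: "\<nu> (k - int j) \<omega> = x j - l * a - (\<Sum>i. \<phi> i * x (j + i))" for j
      proof -
        have s: "summable (\<lambda>i. b (Suc i) * x (j + Suc i))"
          using elim(2)[rule_format, of "k - int j"] by (simp add: x_def diff_diff_eq add_ac)
        have s': "summable (\<lambda>i. l * (b (Suc i) * x (j + Suc i)))" using s by (rule summable_mult)
        hence "summable (\<lambda>i. \<phi> i * x (j + i))"
          by (subst summable_Suc_iff[symmetric]) (simp add: renewal_kernel_def mult.assoc)
        hence "(\<Sum>i. \<phi> i * x (j + i)) = (\<Sum>i. \<phi> (Suc i) * x (j + Suc i))"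
          using suminf_split_head[of "\<lambda>i. \<phi> i * x (j + i)"] by (simp add: \<phi>_0)
        also have "\<dots> = l * (\<Sum>i. b (Suc i) * x (j + Suc i))"
          using suminf_mult[OF s, of l] by (simp add: renewal_kernel_def mult.assoc)
        finally show ?thesis
          by (simp add: \<nu>_def arch_volatility_def x_def diff_diff_eq algebra_simps)
      qed
      have conv: "(\<Sum>i\<le>n. \<bar>z i\<bar> * \<bar>\<phi> (n - i)\<bar>) = (if n = 0 then 0 else z n)" for n
        using z_nonneg \<phi>_nonneg by (simp add: arch_z_renewal)
      have "summable (\<lambda>n. (\<Sum>i\<le>n. \<bar>z i\<bar> * \<bar>\<phi> (n - i)\<bar>) * \<bar>x n\<bar>)"
        unfolding conv by (rule summable_comparison_test'[OF zx, of 0]) (auto simp: z_nonneg)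
      from convolution_exchange[OF this]
      have ex: "(\<lambda>i. z i * (\<Sum>j. \<phi> j * x (i + j))) sums (\<Sum>n. (if n = 0 then 0 else z n) * x n)"
        unfolding arch_z_renewal .
      have zs: "summable (\<lambda>n. z n * x n)"
        by (rule summable_comparison_test'[OF zx, of 0]) (auto simp: z_nonneg abs_mult)
      have "(\<lambda>n. z n * x n - (if n = 0 then x 0 else 0)) sums ((\<Sum>n. z n * x n) - x 0)"
        using zs sums_single[of 0 "\<lambda>_. x 0"] by (intro sums_diff summable_sums) auto
      moreover have "(\<lambda>n. z n * x n - (if n = 0 then x 0 else 0)) = (\<lambda>n. (if n = 0 then 0 else z n) * x n)"
        by auto
      ultimately have hd: "(\<Sum>n. (if n = 0 then 0 else z n) * x n) = (\<Sum>n. z n * x n) - x 0"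
        by (simp add: sums_iff)
      have "(\<lambda>j. z j * x j - z j * (l * a) - z j * (\<Sum>i. \<phi> i * x (j + i)))
          sums ((\<Sum>n. z n * x n) - suminf z * (l * a) - ((\<Sum>n. z n * x n) - x 0))"
        using ex zs z_sum unfolding hd
        by (intro sums_diff sums_mult2 summable_sums) auto
      thus "(\<lambda>j. z j * \<nu> (k - int j) \<omega>) sums (X k \<omega> - l * mean_vol)"
        by (simp add: \<nu>x algebra_simps mean_vol_def x_def)
    qed
  qed
qed

lemma vol_inversion:
  "AE \<omega> in M. \<forall>k. (\<lambda>j. \<zeta> j * \<nu> (k - int j) \<omega>) sums (vol k \<omega> - mean_vol)"
  using X_inversion
proof eventually_elim
  case (elim \<omega>)
  show ?case
  proof
    fix k
    have "(\<lambda>j. z j * \<nu> (k - int j) \<omega> - (if j = 0 then \<nu> k \<omega> else 0)) sums (X k \<omega> - l * mean_vol - \<nu> k \<omega>)"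
      using elim sums_single[of 0 "\<lambda>_. \<nu> k \<omega>"] by (intro sums_diff) auto
    from sums_divide[OF this, of l]
    have "(\<lambda>j. (z j * \<nu> (k - int j) \<omega> - (if j = 0 then \<nu> k \<omega> else 0)) / l)
        sums ((X k \<omega> - l * mean_vol - \<nu> k \<omega>) / l)" .
    moreover have "(z j * \<nu> (k - int j) \<omega> - (if j = 0 then \<nu> k \<omega> else 0)) / l
        = \<zeta> j * \<nu> (k - int j) \<omega>" for j
      by (simp add: \<zeta>_def)
    moreover have "(X k \<omega> - l * mean_vol - \<nu> k \<omega>) / l = vol k \<omega> - mean_vol"
      using l_pos by (simp add: \<nu>_def diff_divide_distrib)
    ultimately show "(\<lambda>j. \<zeta> j * \<nu> (k - int j) \<omega>) sums (vol k \<omega> - mean_vol)" by simp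
  qed
qed

section \<open>Causality of a stationary solution\<close>

abbreviation gen :: "int set \<Rightarrow> 'w measure" where "gen \<equiv> generated_by M \<xi>"

lemma gen_mono:
  assumes "A \<subseteq> B" "f \<in> borel_measurable (gen A)"
  shows "f \<in> borel_measurable (gen B)"
  using assms by (intro measurable_generated_by_mono[OF _ _ assms(2)] generated_by_coordinate)
    (auto simp: generated_by_def)

lemma gen_imp_measurable: "f \<in> borel_measurable (gen A) \<Longrightarrow> f \<in> borel_measurable M"
  by (rule measurable_generated_by_mono[of A \<xi> M M]) auto

lemma \<epsilon>_gen: "k \<in> A \<Longrightarrow> \<epsilon> k \<in> borel_measurable (gen A)"
  using generated_by_coordinate[of k A \<xi> M] unfolding \<epsilon>_def[abs_def] by simp

lemma gen_indep:
  assumes "A \<inter> B = {}" "f \<in> borel_measurable (gen A)" "g \<in> borel_measurable (gen B)"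
  shows "indep_var borel f borel g"
  by (rule indep_var_generated_by[OF indep_\<xi> assms])

text \<open>
  \<open>chain k N n\<close> is the coefficient of \<open>\<nu> (k - n)\<close> after \<open>N\<close> substitutions of
  \<open>\<nu> k = \<epsilon> k * (mean_vol + (\<Sum>j. \<zeta> j * \<nu> (k - j)))\<close> into itself.
\<close>

primrec chain :: "int \<Rightarrow> nat \<Rightarrow> nat \<Rightarrow> 'w \<Rightarrow> real" where
  "chain k 0 = (\<lambda>n \<omega>. if n = 0 then 1 else 0)"
| "chain k (Suc N) = (\<lambda>n \<omega>. \<Sum>i\<le>n. \<zeta> (n - i) * (chain k N i \<omega> * \<epsilon> (k - int i) \<omega>))"

text \<open>
  A link is a chain extended by the factor \<open>\<epsilon>\<close> at its end point. It is the form in which chains of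
  different lengths become orthogonal.
\<close>

definition link :: "int \<Rightarrow> nat \<Rightarrow> nat \<Rightarrow> 'w \<Rightarrow> real" where
  "link k N i \<omega> = chain k N i \<omega> * \<epsilon> (k - int i) \<omega>"

lemma chain_Suc: "chain k (Suc N) n \<omega> = (\<Sum>i\<le>n. \<zeta> (n - i) * link k N i \<omega>)"
  by (simp add: link_def)

text \<open>
  The end point \<open>k - n\<close> itself is not involved: the last factor \<open>\<epsilon>\<close> of a chain sits at the
  beginning of its last step, and every step has length at least \<open>1\<close> as \<open>\<zeta> 0 = 0\<close>.
\<close>

lemma chain_gen: "chain k N n \<in> borel_measurable (gen {k - int n<..k})"
proof (induction N arbitrary: n)
  case (Suc N)
  have eq: "chain k (Suc N) n = (\<lambda>\<omega>. \<Sum>i<n. \<zeta> (n - i) * (chain k N i \<omega> * \<epsilon> (k - int i) \<omega>))"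
    by (auto simp: lessThan_Suc_atMost[symmetric] \<zeta>_def)
  show ?case unfolding eq
  proof (intro borel_measurable_sum borel_measurable_times borel_measurable_const)
    fix i assume i: "i \<in> {..<n}"
    show "chain k N i \<in> borel_measurable (gen {k - int n<..k})"
      by (rule gen_mono[OF _ Suc]) (use i in auto)
    show "\<epsilon> (k - int i) \<in> borel_measurable (gen {k - int n<..k})"
      by (rule \<epsilon>_gen) (use i in auto)
  qed
qed simp

lemma link_gen: "link k N n \<in> borel_measurable (gen {k - int n..k})"
proof -
  have "chain k N n \<in> borel_measurable (gen {k - int n..k})"
    by (rule gen_mono[OF _ chain_gen]) auto
  moreover have "\<epsilon> (k - int n) \<in> borel_measurable (gen {k - int n..k})"
    by (rule \<epsilon>_gen) auto
  ultimately show ?thesis unfolding link_def[abs_def] by (rule borel_measurable_times)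
qed

lemma chain_\<epsilon>_indep: "indep_var borel (chain k N n) borel (\<epsilon> (k - int n))"
  by (rule gen_indep[where A = "{k - int n<..k}" and B = "{k - int n}"])
     (auto intro: chain_gen \<epsilon>_gen)

text \<open>
  The coefficients are the second moments of a single step of a chain. As the kernel is a formal power
  series, its powers are the convolution powers.
\<close>

definition variance_kernel :: "real fps" where "variance_kernel = Abs_fps (\<lambda>j. \<sigma>\<^sup>2 * (\<zeta> j)\<^sup>2)"

text \<open>
  For \<open>i < j\<close> the factor \<open>\<epsilon> (k - j)\<close> of the link ending at \<open>k - j\<close> is centred and independent of
  all the other factors of both links. Hence the links are orthogonal, and the second moments obey the
  recursion of the chains with \<open>\<zeta>\<close> replaced by \<open>\<sigma>\<^sup>2 * \<zeta>\<^sup>2\<close>.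
\<close>

lemma chain_moments:
  "square_integrable M (chain k N n) \<and> expectation (\<lambda>\<omega>. (chain k N n \<omega>)\<^sup>2) = fps_nth (variance_kernel ^ N) n"
proof (induction N arbitrary: n)
  case 0
  show ?case by (auto simp: square_integrable_def prob_space)
next
  case (Suc N)
  have link: "square_integrable M (link k N i)"
    "expectation (\<lambda>\<omega>. (link k N i \<omega>)\<^sup>2) = fps_nth (variance_kernel ^ N) i * \<sigma>\<^sup>2" for i
    using square_integrable_indep_prod[OF chain_\<epsilon>_indep _ \<epsilon>_square_integrable] Suc
    unfolding link_def[abs_def] by (auto simp: expectation_\<epsilon>_square)
  have orth: "expectation (\<lambda>\<omega>. link k N i \<omega> * link k N j \<omega>) = 0" if "i < j" for i j
  proof -
    have "link k N i \<in> borel_measurable (gen {k - int j<..k})"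
      by (rule gen_mono[OF _ link_gen]) (use that in auto)
    from borel_measurable_times[OF this chain_gen[of k N j]]
    have "indep_var borel (\<lambda>\<omega>. link k N i \<omega> * chain k N j \<omega>) borel (\<epsilon> (k - int j))"
      by (intro gen_indep[where A = "{k - int j<..k}" and B = "{k - int j}"] \<epsilon>_gen) auto
    from indep_var_lebesgue_integral[OF this square_integrable_prod square_integrable_imp_integrable]
    have "expectation (\<lambda>\<omega>. (link k N i \<omega> * chain k N j \<omega>) * \<epsilon> (k - int j) \<omega>) = 0"
      using link Suc \<epsilon>_square_integrable by (simp add: expectation_\<epsilon>)
    thus ?thesis by (simp add: link_def mult.assoc)
  qed
  have "expectation (\<lambda>\<omega>. (chain k (Suc N) n \<omega>)\<^sup>2) = (\<Sum>i\<le>n. (\<zeta> (n - i))\<^sup>2 * (fps_nth (variance_kernel ^ N) i * \<sigma>\<^sup>2))"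
    using integral_square_orthogonal_sum[where f = "link k N" and c = "\<lambda>i. \<zeta> (n - i)" and n = n,
        OF link(1) orth]
    by (simp add: link(2) chain_Suc del: chain.simps)
  also have "\<dots> = fps_nth (variance_kernel ^ Suc N) n"
    by (simp only: power_Suc2 fps_mult_nth atLeast0AtMost) (simp add: variance_kernel_def mult_ac)
  finally have "expectation (\<lambda>\<omega>. (chain k (Suc N) n \<omega>)\<^sup>2) = fps_nth (variance_kernel ^ Suc N) n" .
  moreover have "square_integrable M (chain k (Suc N) n)"
    unfolding chain_Suc[abs_def] by (intro square_integrable_sum square_integrable_cmult link)
  ultimately show ?case by blast
qed

lemmas chain_square_integrable = chain_moments[THEN conjunct1]
lemmas chain_second_moment = chain_moments[THEN conjunct2]

lemma link_square_integrable: "square_integrable M (link k N n)"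
  and link_second_moment: "expectation (\<lambda>\<omega>. (link k N n \<omega>)\<^sup>2) = fps_nth (variance_kernel ^ N) n * \<sigma>\<^sup>2"
  using square_integrable_indep_prod[OF chain_\<epsilon>_indep chain_square_integrable \<epsilon>_square_integrable]
  unfolding link_def[abs_def] by (auto simp: expectation_\<epsilon>_square chain_second_moment)

lemma variance_kernel_nonneg: "0 \<le> fps_nth variance_kernel n" by (simp add: variance_kernel_def)

lemma variance_kernel_0: "fps_nth variance_kernel 0 = 0" by (simp add: variance_kernel_def \<zeta>_def)

lemma variance_kernel_power_nonneg: "0 \<le> fps_nth (variance_kernel ^ N) n"
proof -
  have "0 \<le> expectation (\<lambda>\<omega>. (chain 0 N n \<omega>)\<^sup>2)" by simp
  thus ?thesis by (simp only: chain_second_moment)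
qed

text \<open>
  The mass of the variance kernel is \<open>\<Omega>\<^sup>2 < 1\<close>, and its square roots \<open>\<sigma> * \<zeta> n\<close> are summable
  along with \<open>z\<close>.
\<close>

lemma variance_kernel_decay:
  obtains C \<theta> where "0 < \<theta>" "\<theta> < 1" "0 \<le> C" "\<And>N. sqrt_mass_le (variance_kernel ^ N) (C * \<theta> ^ N)"
proof (rule sqrt_mass_power_decay[OF variance_kernel_nonneg])
  have "sqrt (fps_nth variance_kernel n) = \<sigma> * \<zeta> n" for n
    using \<sigma>_pos \<zeta>_nonneg by (simp add: variance_kernel_def real_sqrt_mult)
  thus "summable (\<lambda>n. sqrt (fps_nth variance_kernel n))" using \<zeta>_summable by (simp add: summable_mult)
  have "summable (\<lambda>n. (z n)\<^sup>2)"
    using summable_z_products[OF z_sum, of 0] by (simp add: power2_eq_square)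
  hence zS: "summable (\<lambda>j. (z (Suc j))\<^sup>2)" by (subst summable_Suc_iff)
  have hS: "fps_nth variance_kernel (Suc j) = (\<sigma> / l)\<^sup>2 * (z (Suc j))\<^sup>2" for j
    by (simp add: variance_kernel_def \<zeta>_def power_divide power_mult_distrib)
  have sS: "summable (\<lambda>j. fps_nth variance_kernel (Suc j))" unfolding hS using zS by (rule summable_mult)
  thus s: "summable (fps_nth variance_kernel)" by (simp add: summable_Suc_iff)
  have "(\<Sum>n. fps_nth variance_kernel n) = (\<Sum>j. fps_nth variance_kernel (Suc j))"
    using suminf_split_head[OF s] by (simp add: variance_kernel_0)
  also have "\<dots> = (\<sigma> / l)\<^sup>2 * (\<Sum>j. (z (Suc j))\<^sup>2)"
    unfolding hS by (rule suminf_mult[OF zS])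
  also have "\<dots> = (arch_Omega l \<sigma> b)\<^sup>2"
    using zS by (simp add: arch_Omega_def power_mult_distrib power_divide suminf_nonneg del: arch_z.simps)
  also have "\<dots> < 1"
  proof -
    have "0 \<le> arch_Omega l \<sigma> b"
      using \<sigma>_pos l_pos zS unfolding arch_Omega_def
      by (intro mult_nonneg_nonneg) (auto intro!: suminf_nonneg simp del: arch_z.simps)
    thus ?thesis using Omega by (simp add: power_less_one_iff)
  qed
  finally show "(\<Sum>n. fps_nth variance_kernel n) < 1" .
qed (use that in blast)

lemma variance_kernel_power_summable: "summable (\<lambda>n. sqrt (fps_nth (variance_kernel ^ N) n))"
  using variance_kernel_decay sqrt_mass_le_summable(1) by blast

definition remainder :: "int \<Rightarrow> nat \<Rightarrow> 'w \<Rightarrow> real" where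
  "remainder k N \<omega> = (\<Sum>m. chain k N m \<omega> * \<nu> (k - int m) \<omega>)"

text \<open>
  \<open>mean_vol * layer k N\<close> is the constant term produced by the substitution number \<open>N + 1\<close>.
\<close>

definition layer :: "int \<Rightarrow> nat \<Rightarrow> 'w \<Rightarrow> real" where
  "layer k N \<omega> = (\<Sum>m. link k N m \<omega>)"

lemma link_L1: "expectation (\<lambda>\<omega>. \<bar>link k N n \<omega>\<bar>) \<le> \<sigma> * sqrt (fps_nth (variance_kernel ^ N) n)"
  using integral_Cauchy_Schwarz[OF link_square_integrable square_integrable_const[of 1], of k N n] \<sigma>_pos
  by (simp add: link_second_moment prob_space real_sqrt_mult mult.commute)

text \<open>
  One substitution in every \<open>\<nu> (k - m)\<close> of the remainder, with the terms regrouped by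
  \<open>convolution_exchange\<close>. The chain and \<open>\<nu> (k - n)\<close> may be dependent, but both are square-integrable,
  so the Cauchy-Schwarz inequality yields absolute convergence.
\<close>

lemma remainder_step: "AE \<omega> in M. remainder k N \<omega> = mean_vol * layer k N \<omega> + remainder k (Suc N) \<omega>"
proof -
  obtain K where K: "0 \<le> K" "\<And>k. expectation (\<lambda>\<omega>. (\<nu> k \<omega>)\<^sup>2) \<le> K"
    using \<nu>_bounded by blast
  define s where "s n = \<sigma> * sqrt (fps_nth (variance_kernel ^ N) n)" for n
  have s: "summable s" unfolding s_def using variance_kernel_power_summable by (rule summable_mult)
  have s0: "0 \<le> s n" for n using \<sigma>_pos variance_kernel_power_nonneg by (simp add: s_def)
  have sq_link: "sqrt (expectation (\<lambda>\<omega>. (link k N n \<omega>)\<^sup>2)) = s n" for n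
    using \<sigma>_pos by (simp add: link_second_moment s_def real_sqrt_mult)
  have ae_link: "AE \<omega> in M. summable (\<lambda>n. \<bar>link k N n \<omega>\<bar>)"
    using s link_L1 square_integrable_imp_integrable[OF link_square_integrable] unfolding s_def
    by (intro AE_summable_of_integrals)
  define f where "f n \<omega> = (\<Sum>i\<le>n. \<zeta> (n - i) * \<bar>link k N i \<omega> * \<nu> (k - int n) \<omega>\<bar>)" for n \<omega>
  have int: "integrable M (\<lambda>\<omega>. \<bar>link k N i \<omega> * \<nu> (k - int n) \<omega>\<bar>)" for i n
    using square_integrable_prod[OF link_square_integrable \<nu>_square_integrable] by (rule integrable_abs)
  have f_int: "integrable M (f n)" for n
    unfolding f_def[abs_def] using int by simp
  have f_le: "expectation (\<lambda>\<omega>. \<bar>f n \<omega>\<bar>) \<le> (\<Sum>i\<le>n. s i * \<zeta> (n - i)) * sqrt K" for n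
  proof -
    have "expectation (\<lambda>\<omega>. \<bar>f n \<omega>\<bar>) = expectation (f n)"
      by (intro Bochner_Integration.integral_cong refl)
         (simp add: f_def \<zeta>_nonneg sum_nonneg abs_of_nonneg)
    also have "\<dots> = (\<Sum>i\<le>n. \<zeta> (n - i) * expectation (\<lambda>\<omega>. \<bar>link k N i \<omega> * \<nu> (k - int n) \<omega>\<bar>))"
      unfolding f_def[abs_def] using int by (simp del: abs_mult)
    also have "\<dots> \<le> (\<Sum>i\<le>n. \<zeta> (n - i) * (s i * sqrt K))"
    proof (intro sum_mono mult_left_mono \<zeta>_nonneg)
      fix i
      have "expectation (\<lambda>\<omega>. \<bar>link k N i \<omega> * \<nu> (k - int n) \<omega>\<bar>)
          \<le> s i * sqrt (expectation (\<lambda>\<omega>. (\<nu> (k - int n) \<omega>)\<^sup>2))"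
        using integral_Cauchy_Schwarz[OF link_square_integrable[of k N i]
            \<nu>_square_integrable[of "k - int n"]]
        by (simp only: sq_link)
      also have "\<dots> \<le> s i * sqrt K" using K s0 by (intro mult_left_mono) auto
      finally show "expectation (\<lambda>\<omega>. \<bar>link k N i \<omega> * \<nu> (k - int n) \<omega>\<bar>) \<le> s i * sqrt K" .
    qed
    also have "\<dots> = (\<Sum>i\<le>n. s i * \<zeta> (n - i)) * sqrt K"
      by (simp add: sum_distrib_left sum_distrib_right mult_ac)
    finally show ?thesis .
  qed
  have "summable (\<lambda>n. (\<Sum>i\<le>n. s i * \<zeta> (n - i)) * sqrt K)"
    using summable_Cauchy_nonneg[OF s0 \<zeta>_nonneg s \<zeta>_summable]
    by (intro summable_mult2) (simp add: sums_iff)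
  from AE_summable_of_integrals[OF f_int this f_le]
  have ae_conv: "AE \<omega> in M. summable (\<lambda>n. \<bar>f n \<omega>\<bar>)" .
  show ?thesis
    using ae_link ae_conv vol_inversion \<nu>_eq
  proof eventually_elim
    case (elim \<omega>)
    have "summable (\<lambda>n. (\<Sum>i\<le>n. \<bar>link k N i \<omega>\<bar> * \<bar>\<zeta> (n - i)\<bar>) * \<bar>\<nu> (k - int n) \<omega>\<bar>)"
    proof -
      have "(\<Sum>i\<le>n. \<bar>link k N i \<omega>\<bar> * \<bar>\<zeta> (n - i)\<bar>) * \<bar>\<nu> (k - int n) \<omega>\<bar> = \<bar>f n \<omega>\<bar>" for n
        by (simp add: f_def abs_mult \<zeta>_nonneg sum_nonneg sum_distrib_left mult_ac)
      thus ?thesis using elim(2) by simp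
    qed
    from convolution_exchange[OF this]
    have ex: "(\<lambda>i. link k N i \<omega> * (\<Sum>j. \<zeta> j * \<nu> (k - int (i + j)) \<omega>)) sums remainder k (Suc N) \<omega>"
      by (simp add: remainder_def chain_Suc mult.commute del: chain.simps)
    have vol: "(\<Sum>j. \<zeta> j * \<nu> (k - int (i + j)) \<omega>) = vol (k - int i) \<omega> - mean_vol" for i
      using elim(3)[rule_format, of "k - int i"] by (simp add: sums_iff diff_diff_eq)
    have "summable (\<lambda>n. link k N n \<omega>)" using elim(1) by (rule summable_rabs_cancel)
    hence "(\<lambda>i. link k N i \<omega> * mean_vol) sums (layer k N \<omega> * mean_vol)"
      unfolding layer_def by (intro sums_mult2 summable_sums)
    from sums_add[OF this ex[unfolded vol]]
    have "(\<lambda>i. chain k N i \<omega> * \<nu> (k - int i) \<omega>) sums (layer k N \<omega> * mean_vol + remainder k (Suc N) \<omega>)"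
      using elim(4) by (simp add: link_def algebra_simps)
    thus ?case by (simp add: remainder_def sums_iff mult.commute)
  qed
qed

lemma remainder_zero: "remainder k 0 \<omega> = \<nu> k \<omega>"
proof -
  have "(\<lambda>m. chain k 0 m \<omega> * \<nu> (k - int m) \<omega>) sums \<nu> k \<omega>"
    using sums_single[of 0 "\<lambda>_. \<nu> k \<omega>"] by (rule sums_cong[THEN iffD1, rotated]) auto
  thus ?thesis by (simp add: remainder_def sums_iff)
qed

lemma chain_expansion: "AE \<omega> in M. \<forall>N. \<nu> k \<omega> = mean_vol * (\<Sum>n<N. layer k n \<omega>) + remainder k N \<omega>"
proof -
  have "AE \<omega> in M. \<forall>N. remainder k N \<omega> = mean_vol * layer k N \<omega> + remainder k (Suc N) \<omega>"
    unfolding AE_all_countable using remainder_step by blast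
  thus ?thesis
  proof eventually_elim
    case (elim \<omega>)
    show ?case
    proof
      fix N
      show "\<nu> k \<omega> = mean_vol * (\<Sum>n<N. layer k n \<omega>) + remainder k N \<omega>"
      proof (induction N)
        case (Suc N)
        have "remainder k N \<omega> = mean_vol * layer k N \<omega> + remainder k (Suc N) \<omega>" using elim by blast
        thus ?case using Suc by (simp add: distrib_left)
      qed (simp add: remainder_zero)
    qed
  qed
qed

text \<open>
  The absolute first moment of the remainder is bounded by a geometric sequence in \<open>N\<close>, and its
  summability gives almost sure convergence and not only convergence in mean.
\<close>

lemma remainder_tendsto_0: "AE \<omega> in M. (\<lambda>N. remainder k N \<omega>) \<longlonglongrightarrow> 0"
proof -
  obtain K where K: "0 \<le> K" "\<And>k. expectation (\<lambda>\<omega>. (\<nu> k \<omega>)\<^sup>2) \<le> K"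
    using \<nu>_bounded by blast
  obtain C \<theta> where \<theta>: "0 < \<theta>" "\<theta> < 1" "0 \<le> C" "\<And>N. sqrt_mass_le (variance_kernel ^ N) (C * \<theta> ^ N)"
    using variance_kernel_decay by blast
  define f where "f N m \<omega> = chain k N m \<omega> * \<nu> (k - int m) \<omega>" for N m \<omega>
  have f_int: "integrable M (f N m)" for N m
    unfolding f_def[abs_def] by (rule square_integrable_prod[OF chain_square_integrable \<nu>_square_integrable])
  have f_le: "expectation (\<lambda>\<omega>. \<bar>f N m \<omega>\<bar>) \<le> sqrt (fps_nth (variance_kernel ^ N) m) * sqrt K" for N m
  proof -
    have "expectation (\<lambda>\<omega>. \<bar>f N m \<omega>\<bar>)
        \<le> sqrt (fps_nth (variance_kernel ^ N) m) * sqrt (expectation (\<lambda>\<omega>. (\<nu> (k - int m) \<omega>)\<^sup>2))"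
      using integral_Cauchy_Schwarz[OF chain_square_integrable \<nu>_square_integrable]
      unfolding f_def chain_second_moment .
    also have "\<dots> \<le> sqrt (fps_nth (variance_kernel ^ N) m) * sqrt K"
      using K variance_kernel_power_nonneg by (intro mult_left_mono) auto
    finally show ?thesis .
  qed
  have cs: "summable (\<lambda>m. sqrt (fps_nth (variance_kernel ^ N) m) * sqrt K)" for N
    using variance_kernel_power_summable by (rule summable_mult2)
  have r_int: "integrable M (remainder k N)" for N
    using integrable_series(1)[OF f_int cs f_le] unfolding f_def remainder_def[abs_def] .
  have r_le: "expectation (\<lambda>\<omega>. \<bar>remainder k N \<omega>\<bar>) \<le> C * \<theta> ^ N * sqrt K" for N
  proof -
    have f_int': "integrable M (\<lambda>\<omega>. \<bar>f N m \<omega>\<bar>)" for m using f_int by simp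
    have f_le': "expectation (\<lambda>\<omega>. \<bar>\<bar>f N m \<omega>\<bar>\<bar>) \<le> sqrt (fps_nth (variance_kernel ^ N) m) * sqrt K" for m
      using f_le by simp
    note series = integrable_series[OF f_int' cs f_le']
    have sm: "summable (\<lambda>m. expectation (\<lambda>\<omega>. \<bar>f N m \<omega>\<bar>))"
      by (rule summable_comparison_test'[OF cs, of 0]) (use f_le in auto)
    have "AE \<omega> in M. \<bar>remainder k N \<omega>\<bar> \<le> (\<Sum>m. \<bar>f N m \<omega>\<bar>)"
      using AE_summable_of_integrals[OF f_int cs f_le]
      by eventually_elim (auto simp: remainder_def f_def intro: summable_rabs)
    hence "expectation (\<lambda>\<omega>. \<bar>remainder k N \<omega>\<bar>) \<le> expectation (\<lambda>\<omega>. \<Sum>m. \<bar>f N m \<omega>\<bar>)"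
      using r_int series(1) by (intro integral_mono_AE) auto
    also have "\<dots> = (\<Sum>m. expectation (\<lambda>\<omega>. \<bar>f N m \<omega>\<bar>))" by (rule series(2))
    also have "\<dots> \<le> (\<Sum>m. sqrt (fps_nth (variance_kernel ^ N) m) * sqrt K)"
      by (intro suminf_le f_le sm cs)
    also have "\<dots> = (\<Sum>m. sqrt (fps_nth (variance_kernel ^ N) m)) * sqrt K"
      by (rule suminf_mult2[OF variance_kernel_power_summable, symmetric])
    also have "\<dots> \<le> C * \<theta> ^ N * sqrt K"
      using sqrt_mass_le_summable(2)[OF \<theta>(4)] K by (intro mult_right_mono) auto
    finally show ?thesis .
  qed
  have "summable (\<lambda>N. C * \<theta> ^ N * sqrt K)"
    using \<theta> by (intro summable_mult2 summable_mult summable_geometric) auto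
  from AE_summable_of_integrals[OF r_int this r_le]
  show ?thesis by eventually_elim (auto dest: summable_LIMSEQ_zero simp: tendsto_rabs_zero_iff)
qed

text \<open>
  Once the remainder has disappeared, \<open>\<nu> k\<close> is the limit of sums of links, all of which involve the
  innovations up to time \<open>k\<close> only.
\<close>

lemma \<nu>_causal: "\<exists>f\<in>borel_measurable (gen {..k}). AE \<omega> in M. \<nu> k \<omega> = f \<omega>"
proof
  define f where "f \<omega> = lim (\<lambda>N. mean_vol * (\<Sum>n<N. layer k n \<omega>))" for \<omega>
  have "link k n m \<in> borel_measurable (gen {..k})" for n m
    by (rule gen_mono[OF _ link_gen]) auto
  hence "layer k n \<in> borel_measurable (gen {..k})" for n
    unfolding layer_def[abs_def] by (rule borel_measurable_suminf)
  thus "f \<in> borel_measurable (gen {..k})"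
    unfolding f_def[abs_def] by (intro borel_measurable_lim_metric) simp
  show "AE \<omega> in M. \<nu> k \<omega> = f \<omega>"
    using chain_expansion[of k] remainder_tendsto_0[of k]
  proof eventually_elim
    case (elim \<omega>)
    have "(\<lambda>N. \<nu> k \<omega> - remainder k N \<omega>) \<longlonglongrightarrow> \<nu> k \<omega> - 0"
      by (intro tendsto_diff tendsto_const elim)
    moreover have "\<nu> k \<omega> - remainder k N \<omega> = mean_vol * (\<Sum>n<N. layer k n \<omega>)" for N
      using elim(1)[rule_format, of N] by simp
    ultimately show ?case by (simp add: f_def limI)
  qed
qed

lemma vol_causal: "\<exists>f\<in>borel_measurable (gen {..<k}). AE \<omega> in M. vol k \<omega> = f \<omega>"
proof -
  obtain g where g: "\<And>k. g k \<in> borel_measurable (gen {..k})" "\<And>k. AE \<omega> in M. \<nu> k \<omega> = g k \<omega>"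
    using \<nu>_causal by metis
  define f where "f \<omega> = mean_vol + (\<Sum>j. \<zeta> (Suc j) * g (k - int (Suc j)) \<omega>)" for \<omega>
  have "g (k - int (Suc j)) \<in> borel_measurable (gen {..<k})" for j
    by (rule gen_mono[OF _ g(1)]) auto
  hence "f \<in> borel_measurable (gen {..<k})"
    unfolding f_def[abs_def] by (intro borel_measurable_add borel_measurable_suminf) auto
  moreover have "AE \<omega> in M. \<forall>k. \<nu> k \<omega> = g k \<omega>"
    unfolding AE_all_countable using g by blast
  with vol_inversion have "AE \<omega> in M. vol k \<omega> = f \<omega>"
  proof eventually_elim
    case (elim \<omega>)
    have "(\<lambda>j. \<zeta> j * \<nu> (k - int j) \<omega>) sums (vol k \<omega> - mean_vol)" using elim by blast
    hence "(\<lambda>j. \<zeta> (Suc j) * \<nu> (k - int (Suc j)) \<omega>) sums (vol k \<omega> - mean_vol)"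
      by (subst sums_Suc_iff) (simp add: \<zeta>_def)
    thus ?case using elim by (simp add: f_def sums_iff)
  qed
  ultimately show ?thesis by blast
qed

section \<open>The autocovariance function\<close>

lemma expectation_\<xi>_square_pos: "0 < expectation (\<lambda>\<omega>. (\<xi> k \<omega>)\<^sup>2)"
  and expectation_\<xi>_square: "expectation (\<lambda>\<omega>. (\<xi> k \<omega>)\<^sup>2) = \<sigma>\<^sup>2 + l\<^sup>2"
proof -
  have i1: "integrable M (\<epsilon> k)" by (rule square_integrable_imp_integrable[OF \<epsilon>_square_integrable])
  have i2: "integrable M (\<lambda>\<omega>. (\<epsilon> k \<omega>)\<^sup>2)" using \<epsilon>_square_integrable by (simp add: square_integrable_def)
  have "expectation (\<lambda>\<omega>. (\<xi> k \<omega>)\<^sup>2) = expectation (\<lambda>\<omega>. (\<epsilon> k \<omega>)\<^sup>2 + 2 * l * \<epsilon> k \<omega> + l\<^sup>2)"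
    by (intro Bochner_Integration.integral_cong refl)
       (simp add: \<epsilon>_def power2_eq_square algebra_simps)
  also have "\<dots> = \<sigma>\<^sup>2 + l\<^sup>2"
    using i1 i2 by (simp add: expectation_\<epsilon> expectation_\<epsilon>_square prob_space)
  finally show "expectation (\<lambda>\<omega>. (\<xi> k \<omega>)\<^sup>2) = \<sigma>\<^sup>2 + l\<^sup>2" .
  thus "0 < expectation (\<lambda>\<omega>. (\<xi> k \<omega>)\<^sup>2)" using \<sigma>_pos l_pos by (simp add: pos_add_strict)
qed

lemma vol_version:
  obtains f where "f \<in> borel_measurable (gen {..<k})" "AE \<omega> in M. vol k \<omega> = f \<omega>"
    "square_integrable M f"
proof -
  obtain f where f: "f \<in> borel_measurable (gen {..<k})" "AE \<omega> in M. vol k \<omega> = f \<omega>"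
    using vol_causal by blast
  thus ?thesis
    using that square_integrable_cong_AE[OF vol_square_integrable gen_imp_measurable[OF f(1)] f(2)] by blast
qed

text \<open>
  Causality makes the volatility independent of the present innovation. Applied to \<open>\<xi> k\<close> it shows
  that stationarity of \<open>X\<close> passes to the second moment of the volatility, and applied to \<open>\<epsilon> k\<close> it
  gives the second moment of \<open>\<nu>\<close>.
\<close>

lemma second_moment_factor:
  assumes Y: "Y \<in> borel_measurable (gen {k})" "square_integrable M Y"
    and Z: "AE \<omega> in M. Z \<omega> = Y \<omega> * vol k \<omega>" "Z \<in> borel_measurable M"
  shows "expectation (\<lambda>\<omega>. (Z \<omega>)\<^sup>2) = expectation (\<lambda>\<omega>. (Y \<omega>)\<^sup>2) * expectation (\<lambda>\<omega>. (vol k \<omega>)\<^sup>2)"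
proof -
  obtain f where f: "f \<in> borel_measurable (gen {..<k})" "AE \<omega> in M. vol k \<omega> = f \<omega>"
    "square_integrable M f" by (rule vol_version)
  note [measurable] = Y(2)[THEN square_integrable_measurable] f(3)[THEN square_integrable_measurable]
    vol_square_integrable[THEN square_integrable_measurable, of k] Z(2)
  have ind: "indep_var borel Y borel f" by (rule gen_indep[OF _ Y(1) f(1)]) auto
  have "expectation (\<lambda>\<omega>. (Z \<omega>)\<^sup>2) = expectation (\<lambda>\<omega>. (Y \<omega> * f \<omega>)\<^sup>2)"
  proof (rule integral_cong_AE)
    show "AE \<omega> in M. (Z \<omega>)\<^sup>2 = (Y \<omega> * f \<omega>)\<^sup>2" using Z(1) f(2) by eventually_elim simp
  qed measurable
  also have "\<dots> = expectation (\<lambda>\<omega>. (Y \<omega>)\<^sup>2) * expectation (\<lambda>\<omega>. (f \<omega>)\<^sup>2)"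
    by (rule square_integrable_indep_prod(2)[OF ind Y(2) f(3)])
  also have "expectation (\<lambda>\<omega>. (f \<omega>)\<^sup>2) = expectation (\<lambda>\<omega>. (vol k \<omega>)\<^sup>2)"
  proof (rule integral_cong_AE)
    show "AE \<omega> in M. (f \<omega>)\<^sup>2 = (vol k \<omega>)\<^sup>2" using f(2) by eventually_elim simp
  qed measurable
  finally show ?thesis .
qed

definition innovation_var :: real where "innovation_var = \<sigma>\<^sup>2 * (moment2_X / (\<sigma>\<^sup>2 + l\<^sup>2))"

lemma vol_second_moment: "expectation (\<lambda>\<omega>. (vol k \<omega>)\<^sup>2) = moment2_X / (\<sigma>\<^sup>2 + l\<^sup>2)"
proof -
  have "expectation (\<lambda>\<omega>. (X k \<omega>)\<^sup>2) = expectation (\<lambda>\<omega>. (\<xi> k \<omega>)\<^sup>2) * expectation (\<lambda>\<omega>. (vol k \<omega>)\<^sup>2)"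
  proof (rule second_moment_factor)
    show "\<xi> k \<in> borel_measurable (gen {k})" by (rule generated_by_coordinate) simp
    show "AE \<omega> in M. X k \<omega> = \<xi> k \<omega> * vol k \<omega>"
      using solution_AE by eventually_elim simp
  qed (use \<xi>_square_integrable X_square_integrable square_integrable_measurable in auto)
  thus ?thesis using expectation_\<xi>_square_pos[of k] l_pos
    by (simp add: X_second_moment expectation_\<xi>_square)
qed

lemma \<nu>_second_moment: "expectation (\<lambda>\<omega>. (\<nu> k \<omega>)\<^sup>2) = innovation_var"
proof -
  have "expectation (\<lambda>\<omega>. (\<nu> k \<omega>)\<^sup>2) = expectation (\<lambda>\<omega>. (\<epsilon> k \<omega>)\<^sup>2) * expectation (\<lambda>\<omega>. (vol k \<omega>)\<^sup>2)"
  proof (rule second_moment_factor)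
    show "\<epsilon> k \<in> borel_measurable (gen {k})" by (rule \<epsilon>_gen) simp
    show "AE \<omega> in M. \<nu> k \<omega> = \<epsilon> k \<omega> * vol k \<omega>" using \<nu>_eq by eventually_elim simp
  qed (use \<epsilon>_square_integrable \<nu>_square_integrable square_integrable_measurable in auto)
  thus ?thesis by (simp add: expectation_\<epsilon>_square vol_second_moment innovation_var_def)
qed

text \<open>
  If \<open>X\<close> had second moment \<open>0\<close>, it would vanish almost surely, and the equations would leave
  the volatility equal to \<open>a > 0\<close>; but its second moment is proportional to that of \<open>X\<close>.
\<close>

lemma innovation_var_pos: "0 < innovation_var"
proof -
  have "moment2_X \<noteq> 0"
  proof
    assume "moment2_X = 0"
    hence "AE \<omega> in M. (X k \<omega>)\<^sup>2 = 0" for k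
      using X_second_moment[of k] X_square_integrable[of k]
      by (intro integral_nonneg_eq_0_iff_AE[THEN iffD1]) (auto simp: square_integrable_def)
    hence "AE \<omega> in M. \<forall>k. (X k \<omega>)\<^sup>2 = 0" unfolding AE_all_countable by blast
    hence "AE \<omega> in M. vol 0 \<omega> = a" by eventually_elim (simp add: arch_volatility_def)
    hence "expectation (\<lambda>\<omega>. (vol 0 \<omega>)\<^sup>2) = expectation (\<lambda>\<omega>. a\<^sup>2)"
      using vol_square_integrable[THEN square_integrable_measurable, of 0]
      by (intro integral_cong_AE) auto
    thus False using \<open>moment2_X = 0\<close> a_pos by (simp add: vol_second_moment prob_space)
  qed
  moreover have "0 \<le> moment2_X" by (simp add: moment2_X_def)
  ultimately show ?thesis using \<sigma>_pos l_pos by (simp add: innovation_var_def pos_add_strict)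
qed

lemma \<nu>_orthogonal_to_past:
  assumes g: "g \<in> borel_measurable (gen {..<k})" "square_integrable M g"
  shows "expectation (\<lambda>\<omega>. g \<omega> * \<nu> k \<omega>) = 0"
proof -
  obtain f where f: "f \<in> borel_measurable (gen {..<k})" "AE \<omega> in M. vol k \<omega> = f \<omega>"
    "square_integrable M f" by (rule vol_version)
  note [measurable] = g(2)[THEN square_integrable_measurable] f(3)[THEN square_integrable_measurable]
    \<nu>_square_integrable[THEN square_integrable_measurable, of k]
    \<epsilon>_square_integrable[THEN square_integrable_measurable, of k]
  have ind: "indep_var borel (\<lambda>\<omega>. g \<omega> * f \<omega>) borel (\<epsilon> k)"
    by (rule gen_indep[OF _ borel_measurable_times[OF g(1) f(1)] \<epsilon>_gen, of "{k}"]) auto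
  have "expectation (\<lambda>\<omega>. g \<omega> * \<nu> k \<omega>) = expectation (\<lambda>\<omega>. (g \<omega> * f \<omega>) * \<epsilon> k \<omega>)"
  proof (rule integral_cong_AE)
    show "AE \<omega> in M. g \<omega> * \<nu> k \<omega> = g \<omega> * f \<omega> * \<epsilon> k \<omega>"
      using \<nu>_eq f(2) by eventually_elim simp
  qed measurable
  also have "\<dots> = 0"
    using indep_var_lebesgue_integral[OF ind square_integrable_prod[OF g(2) f(3)]
        square_integrable_imp_integrable[OF \<epsilon>_square_integrable]]
    by (simp add: expectation_\<epsilon>)
  finally show ?thesis .
qed

lemma expectation_\<nu>: "expectation (\<nu> k) = 0"
  using \<nu>_orthogonal_to_past[of "\<lambda>_. 1" k] by (simp add: square_integrable_const)

lemma \<nu>_orthogonal: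
  assumes "j < k"
  shows "expectation (\<lambda>\<omega>. \<nu> j \<omega> * \<nu> k \<omega>) = 0"
proof -
  obtain g where g: "g \<in> borel_measurable (gen {..j})" "AE \<omega> in M. \<nu> j \<omega> = g \<omega>"
    using \<nu>_causal by blast
  have sq: "square_integrable M g"
    by (rule square_integrable_cong_AE[OF \<nu>_square_integrable gen_imp_measurable[OF g(1)] g(2)])
  have g': "g \<in> borel_measurable (gen {..<k})"
    by (rule gen_mono[OF _ g(1)]) (use assms in auto)
  note [measurable] = sq[THEN square_integrable_measurable] \<nu>_square_integrable[THEN square_integrable_measurable]
  have "expectation (\<lambda>\<omega>. \<nu> j \<omega> * \<nu> k \<omega>) = expectation (\<lambda>\<omega>. g \<omega> * \<nu> k \<omega>)"
  proof (rule integral_cong_AE)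
    show "AE \<omega> in M. \<nu> j \<omega> * \<nu> k \<omega> = g \<omega> * \<nu> k \<omega>"
      using g(2) by eventually_elim simp
  qed measurable
  thus ?thesis using \<nu>_orthogonal_to_past[OF g' sq] by simp
qed

lemma \<nu>_covariance: "expectation (\<lambda>\<omega>. \<nu> j \<omega> * \<nu> k \<omega>) = (if j = k then innovation_var else 0)"
  using \<nu>_orthogonal[of j k] \<nu>_orthogonal[of k j] \<nu>_second_moment[of k]
  by (cases j k rule: linorder_cases) (auto simp: power2_eq_square mult.commute)

text \<open>
  The inversion formula may be paired term by term with any square-integrable function; pairing it with
  \<open>\<nu>\<close> and then with \<open>X\<close> itself produces the autocovariance.
\<close>

lemma expectation_linear_filter:
  assumes Y: "square_integrable M Y"
  shows "expectation (\<lambda>\<omega>. (X k \<omega> - l * mean_vol) * Y \<omega>) = (\<Sum>j. z j * expectation (\<lambda>\<omega>. \<nu> (k - int j) \<omega> * Y \<omega>))"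
proof -
  note [measurable] = Y[THEN square_integrable_measurable] X_square_integrable[THEN square_integrable_measurable]
    \<nu>_square_integrable[THEN square_integrable_measurable]
  define q where "q = sqrt innovation_var * sqrt (expectation (\<lambda>\<omega>. (Y \<omega>)\<^sup>2))"
  have int: "integrable M (\<lambda>\<omega>. z j * (\<nu> (k - int j) \<omega> * Y \<omega>))" for j
    using square_integrable_prod[OF \<nu>_square_integrable Y] by simp
  have le: "expectation (\<lambda>\<omega>. \<bar>z j * (\<nu> (k - int j) \<omega> * Y \<omega>)\<bar>) \<le> z j * q" for j
  proof -
    have "expectation (\<lambda>\<omega>. \<bar>z j * (\<nu> (k - int j) \<omega> * Y \<omega>)\<bar>)
        = z j * expectation (\<lambda>\<omega>. \<bar>\<nu> (k - int j) \<omega> * Y \<omega>\<bar>)"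
      using z_nonneg by (simp add: abs_mult[of "z j"] del: arch_z.simps)
    also have "\<dots> \<le> z j * q"
      using integral_Cauchy_Schwarz[OF \<nu>_square_integrable Y, of "k - int j"]
      unfolding \<nu>_second_moment q_def by (intro mult_left_mono z_nonneg)
    finally show ?thesis .
  qed
  have "expectation (\<lambda>\<omega>. (X k \<omega> - l * mean_vol) * Y \<omega>) = expectation (\<lambda>\<omega>. \<Sum>j. z j * (\<nu> (k - int j) \<omega> * Y \<omega>))"
  proof (rule integral_cong_AE)
    show "AE \<omega> in M. (X k \<omega> - l * mean_vol) * Y \<omega> = (\<Sum>j. z j * (\<nu> (k - int j) \<omega> * Y \<omega>))"
      using X_inversion
    proof eventually_elim
      case (elim \<omega>)
      have "(\<lambda>j. z j * \<nu> (k - int j) \<omega> * Y \<omega>) sums ((X k \<omega> - l * mean_vol) * Y \<omega>)"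
        using elim by (intro sums_mult2) blast
      thus ?case by (simp add: sums_iff mult.assoc)
    qed
  qed measurable
  also have "\<dots> = (\<Sum>j. z j * expectation (\<lambda>\<omega>. \<nu> (k - int j) \<omega> * Y \<omega>))"
    using integrable_series(2)[OF int summable_mult2[OF z_sum] le] by simp
  finally show ?thesis .
qed

lemma expectation_X: "expectation (X k) = l * mean_vol"
proof -
  have "expectation (\<lambda>\<omega>. X k \<omega> - l * mean_vol) = 0"
    using expectation_linear_filter[OF square_integrable_const[of 1], of k] by (simp add: expectation_\<nu>)
  thus ?thesis
    using square_integrable_imp_integrable[OF X_square_integrable, of k] by (simp add: prob_space)
qed

lemma autocovariance:
  "cov M (X n) (X (n + int k)) = innovation_var * (\<Sum>i. z i * z (i + k))"
proof -
  have sq: "square_integrable M (\<lambda>\<omega>. X m \<omega> - l * mean_vol)" for m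
    using square_integrable_add[OF X_square_integrable square_integrable_const[of "- (l * mean_vol)"]] by simp
  have inner: "expectation (\<lambda>\<omega>. (X (n + int k) \<omega> - l * mean_vol) * \<nu> (n - int i) \<omega>) = z (i + k) * innovation_var" for i
  proof -
    have "z j * expectation (\<lambda>\<omega>. \<nu> (n + int k - int j) \<omega> * \<nu> (n - int i) \<omega>)
        = (if j = i + k then z (i + k) * innovation_var else 0)" for j
      by (auto simp: \<nu>_covariance)
    thus ?thesis
      unfolding expectation_linear_filter[OF \<nu>_square_integrable]
      using sums_single[of "i + k" "\<lambda>_. z (i + k) * innovation_var"] by (simp add: sums_iff)
  qed
  have "cov M (X n) (X (n + int k)) = expectation (\<lambda>\<omega>. (X n \<omega> - l * mean_vol) * (X (n + int k) \<omega> - l * mean_vol))"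
    by (simp add: cov_def expectation_X)
  also have "\<dots> = (\<Sum>i. z i * expectation (\<lambda>\<omega>. \<nu> (n - int i) \<omega> * (X (n + int k) \<omega> - l * mean_vol)))"
    by (rule expectation_linear_filter[OF sq])
  also have "\<dots> = (\<Sum>i. z i * (z (i + k) * innovation_var))"
    using inner by (simp add: mult.commute)
  also have "\<dots> = innovation_var * (\<Sum>i. z i * z (i + k))"
    using suminf_mult[OF summable_z_products[OF z_sum], of innovation_var] by (simp add: mult_ac)
  finally show ?thesis .
qed

end

theorem theorem9:
  fixes M :: "'w measure"
    and \<xi> X :: "int \<Rightarrow> 'w \<Rightarrow> real"
    and a lambda1 \<sigma> r :: real
    and b \<gamma> :: "nat \<Rightarrow> real"
    and \<rho> :: "int \<Rightarrow> real"
  assumes "prob_space M"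
    and "prob_space.indep_vars M (\<lambda>_. borel) \<xi> UNIV"
    and "\<And>k. distr M borel (\<xi> k) = distr M borel (\<xi> 0)"
    and "\<And>k. AE \<omega> in M. 0 \<le> \<xi> k \<omega>"
    and "integrable M (\<xi> 0)"
    and "integrable M (\<lambda>\<omega>. (\<xi> 0 \<omega>)\<^sup>2)"
    and "lambda1 = prob_space.expectation M (\<xi> 0)" and "0 < lambda1"
    and "\<sigma> = sqrt (prob_space.variance M (\<xi> 0))" and "0 < \<sigma>"
    and "0 < a"
    and "\<And>j. 1 \<le> j \<Longrightarrow> 0 \<le> b j"
    and "\<exists>j\<ge>1. b j \<noteq> 0"
    and "summable (\<lambda>j. b (Suc j))" and "lambda1 * (\<Sum>j. b (Suc j)) < 1"
    and "arch_Omega lambda1 \<sigma> b < 1"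
    and "arch_solution M a b \<xi> X"
    and "weakly_stationary M X"
    and "\<And>n k. \<rho> k = cov M (X n) (X (n + k))"
    and "0 < r" and "r \<le> 1"
    and "\<gamma> \<in> weight_class_down r"
  shows "(summable (\<lambda>j. b (Suc j) / r ^ Suc j) \<and>
          lambda1 * (\<Sum>j. b (Suc j) / r ^ Suc j) < 1 \<and>
          (\<exists>C0>0. \<forall>n\<ge>1. b n \<le> C0 * \<gamma> n))
     \<longleftrightarrow> (\<exists>C2>0. \<forall>n. \<rho> (int n) \<le> C2 * \<gamma> n)"
proof -
  interpret prob_space M by fact
  interpret arch_process M lambda1 b \<xi> X a \<sigma>
    using assms by unfold_locales auto
  have "\<rho> (int n) = innovation_var * (\<Sum>i. z i * z (i + n))" for n
    using autocovariance[of 0 n] assms(19)[of "int n" 0] by simp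
  from autocorrelation_weight_iff[OF \<open>0 < r\<close> \<open>\<gamma> \<in> weight_class_down r\<close> z_sum innovation_var_pos this]
  show ?thesis .
qed

end
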